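(* Let $n\ge1$, $p\ge2$, $t_1>0$, $t_2>0$, and let $f\in\mathcal{C}^2(\mathbb{B}^n)\cap\mathcal{H}_g^p(\mathbb{B}^n)$ satisfy $$\Delta\big(|f(z)|^{p}\big)\ge a_{1}(z)\|D_{f}(z)\|^{t_{1}}+b_{1}(z)|f(z)|^{t_{2}}+c_{1}(z)\quad(z\in\mathbb{B}^n),$$ where $a_1,b_1,c_1$ are real-valued nonnegative continuous functions on $\mathbb{B}^n$ with $\inf_{\mathbb{B}^n}a_1+\inf_{\mathbb{B}^n}b_1>0$ and $\inf_{\mathbb{B}^n}c_1\ge0$. (1) If $\inf_{\mathbb{B}^n}a_1>0$, then $f\in\mathcal{D}_{1,t_1}(\mathbb{B}^n)$. (2) If $\inf_{\mathbb{B}^n}b_1>0$, then $f\in b_{1,t_2}(\mathbb{B}^n)$.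
   Context: $\mathbb{B}^n$ is the open unit ball of $\mathbb{C}^n$, $d(z)=1-|z|$, $dV_N$ the normalized volume measure, $d\sigma$ the normalized surface measure on $\partial\mathbb{B}^n$, $\Delta=4\sum_k\partial^2/\partial z_k\partial\overline{z}_k$. $\|D_f\|=\big(\sum_k(|f_{z_k}|^2+|f_{\overline z_k}|^2)\big)^{1/2}$. $\mathcal{H}_g^p(\mathbb{B}^n)$ is the set of measurable $f$ with $M_p(r,f)=\big(\int_{\partial\mathbb{B}^n}|f(r\zeta)|^pd\sigma(\zeta)\big)^{1/p}$ defined for all $r\in(0,1)$ and $\sup_{0<r<1}M_p(r,f)<\infty$. $\mathcal{D}_{\nu,t}(\mathbb{B}^n)$ ($\nu\ge0$, $0<t<\infty$) is the set of $f\in\mathcal{C}^1(\mathbb{B}^n)$ with $\int_{\mathbb{B}^n}d^\nu\|D_f\|^t\,dV_N<\infty$. $b_{\nu,\mu}(\mathbb{B}^n)$ ($\nu>-1$, $0<\mu<\infty$) is the set of continuous $f$ with $\int_{\mathbb{B}^n}d^\nu|f|^\mu\,dV_N<\infty$. *)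

theory Defs
  imports "HOL-Analysis.Analysis"
begin

abbreviation unit_ball :: "(complex^'n) set" where
  "unit_ball \<equiv> ball 0 1"

definition dist_bd :: "complex^'n \<Rightarrow> real" where
  "dist_bd z = 1 - norm z"

definition dVN :: "(complex^'n) measure" where
  "dVN = density lebesgue
     (\<lambda>z. ennreal (indicator unit_ball z / measure lebesgue (unit_ball :: (complex^'n) set)))"

text \<open>Normalized surface measure on the unit sphere: the image of the normalized
  volume measure under radial projection z \<mapsto> z/|z| (Rudin's characterization).\<close>
definition dsigma :: "(complex^'n) measure" where
  "dsigma = distr dVN borel (\<lambda>z. z /\<^sub>R norm z)"

definition pderiv_dir :: "(complex^'n \<Rightarrow> 'b::real_normed_vector) \<Rightarrow> complex^'n \<Rightarrow> complex^'n \<Rightarrow> 'b" where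
  "pderiv_dir f v z = frechet_derivative f (at z) v"

definition C1_on :: "(complex^'n) set \<Rightarrow> (complex^'n \<Rightarrow> 'b::real_normed_vector) \<Rightarrow> bool" where
  "C1_on S f \<longleftrightarrow> (\<forall>z\<in>S. f differentiable (at z)) \<and>
     (\<forall>v\<in>Basis. continuous_on S (pderiv_dir f v))"

definition C2_on :: "(complex^'n) set \<Rightarrow> (complex^'n \<Rightarrow> 'b::real_normed_vector) \<Rightarrow> bool" where
  "C2_on S f \<longleftrightarrow> (\<forall>z\<in>S. f differentiable (at z)) \<and>
     (\<forall>v\<in>Basis. \<forall>z\<in>S. pderiv_dir f v differentiable (at z)) \<and>
     (\<forall>v\<in>Basis. \<forall>w\<in>Basis. continuous_on S (pderiv_dir (pderiv_dir f v) w))"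

definition dz :: "(complex^'n \<Rightarrow> complex) \<Rightarrow> 'n \<Rightarrow> complex^'n \<Rightarrow> complex" where
  "dz f k z = (pderiv_dir f (axis k 1) z - \<i> * pderiv_dir f (axis k \<i>) z) / 2"

definition dzbar :: "(complex^'n \<Rightarrow> complex) \<Rightarrow> 'n \<Rightarrow> complex^'n \<Rightarrow> complex" where
  "dzbar f k z = (pderiv_dir f (axis k 1) z + \<i> * pderiv_dir f (axis k \<i>) z) / 2"

definition normDf :: "(complex^'n \<Rightarrow> complex) \<Rightarrow> complex^'n \<Rightarrow> real" where
  "normDf f z = sqrt (\<Sum>k\<in>UNIV. (cmod (dz f k z))\<^sup>2 + (cmod (dzbar f k z))\<^sup>2)"

text \<open>Laplacian Delta = 4 sum d^2/dz_k dzbar_k = sum of second real partials over the real basis.\<close>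
definition laplacian :: "(complex^'n \<Rightarrow> real) \<Rightarrow> complex^'n \<Rightarrow> real" where
  "laplacian u z = (\<Sum>v\<in>Basis. pderiv_dir (pderiv_dir u v) v z)"

definition Mp_pow :: "real \<Rightarrow> real \<Rightarrow> (complex^'n \<Rightarrow> complex) \<Rightarrow> ennreal" where
  "Mp_pow p r f = (\<integral>\<^sup>+ \<zeta>. ennreal (cmod (f (r *\<^sub>R \<zeta>)) powr p) \<partial>dsigma)"

definition Hg :: "real \<Rightarrow> (complex^'n \<Rightarrow> complex) set" where
  "Hg p = {f. f \<in> borel_measurable (restrict_space lebesgue unit_ball) \<and>
              (\<forall>r\<in>{0<..<1}. Mp_pow p r f < \<infinity>) \<and>
              (\<exists>C::real. \<forall>r\<in>{0<..<1}. Mp_pow p r f \<le> ennreal C)}"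

definition Dclass :: "real \<Rightarrow> real \<Rightarrow> (complex^'n \<Rightarrow> complex) set" where
  "Dclass \<nu> t = {f. C1_on unit_ball f \<and>
     (\<integral>\<^sup>+ z. ennreal (dist_bd z powr \<nu> * normDf f z powr t) \<partial>dVN) < \<infinity>}"

definition bclass :: "real \<Rightarrow> real \<Rightarrow> (complex^'n \<Rightarrow> complex) set" where
  "bclass \<nu> \<mu> = {f. continuous_on unit_ball f \<and>
     (\<integral>\<^sup>+ z. ennreal (dist_bd z powr \<nu> * cmod (f z) powr \<mu>) \<partial>dVN) < \<infinity>}"

end

(* The function u = |f|^p is twice differentiable with locally bounded second derivatives and
   Delta u >= 0.  Integrating by parts against phi(z) = eta(1 - e - |z|^2), where eta is a C^2
   smoothing at scale e of the positive part, gives int phi Delta u = int u Delta phi.  Since eta is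
   increasing, Delta phi <= 4 eta''(1 - e - |z|^2), which is at most 4/e and lives on a spherical
   shell of width at most 2e.  The bound on the spherical means of u makes the integral of u over
   that shell O(e), so int phi Delta u is bounded independently of e; letting e tend to 0, Fatou's
   lemma yields int (1 - |z|^2) Delta u < infinity, and Delta u dominates both integrands. *)

theory Submission
  imports Defs
begin

text \<open>At zeros of \<open>f\<close> the second derivatives of |f|^p contain |f|^(p-4), which is
  singular for p < 4, but two factors of size |f| accompany it; this is what p \<ge> 2 is for. Only
  local bounds are extracted, not continuity of Delta u, and the rest is built to live on bounds.
  The integration by parts is done one real direction at a time, on difference quotients with
  dominated convergence, so bounded pure second derivatives suffice. Fatou is applied to the
  continuous right-hand side of the hypothesis rather than to Delta u, so that measurability is
  free. The cutoff is needed because nothing is known about u or its gradient at the sphere: with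
  support in a smaller closed ball there are no boundary terms. The weight is a function of |z|^2
  and not of |z| because it is then smooth at the origin and its Laplacian is explicit; since 1 -
  |z| \<le> 1 - |z|^2 in the ball, the weight d is recovered at the end.\<close>

subsection \<open>Derivatives of powers of the norm\<close>

text \<open>Superlinear decay at the origin is differentiability there with derivative 0; the bound
  at \<open>x = 0\<close> also forces \<open>F 0 = 0\<close>. This treats the point where the chain
  rule through \<open>norm\<close> breaks down, both for \<open>norm x powr p\<close> and for its
  gradient.\<close>

lemma has_derivative_0_of_powr_bound:
  fixes F :: "'a::real_normed_vector \<Rightarrow> 'b::real_normed_vector"
  assumes q: "q > 1" and bd: "\<And>x. norm (F x) \<le> C * norm x powr q"
  shows "(F has_derivative (\<lambda>_. 0)) (at 0)"
proof -
  have F0: "F 0 = 0" using bd[of 0] by simp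
  have *: "((\<lambda>x. C * norm x powr (q - 1)) \<longlongrightarrow> 0) (at (0::'a))"
  proof -
    have "((\<lambda>x::'a. norm x) \<longlongrightarrow> 0) (at 0)" by (rule tendsto_norm_zero) simp
    then have "((\<lambda>x::'a. norm x powr (q - 1)) \<longlongrightarrow> 0 powr (q-1)) (at 0)"
      using q by (intro tendsto_powr2) auto
    from tendsto_mult[OF tendsto_const[of C] this] show ?thesis using q by simp
  qed
  have "((\<lambda>x. norm (F x - F 0 - 0) / norm (x - 0)) \<longlongrightarrow> 0) (at 0)"
  proof (rule tendsto_sandwich[OF _ _ tendsto_const *])
    show "\<forall>\<^sub>F x in at 0. norm (F x - F 0 - 0) / norm (x - 0) \<le> C * norm x powr (q - 1)"
      unfolding eventually_at_filter
    proof (intro always_eventually allI impI)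
      fix x :: 'a assume "x \<noteq> 0"
      then have "norm x powr q = norm x powr (q-1) * norm x"
        by (simp add: powr_diff)
      then show "norm (F x - F 0 - 0) / norm (x - 0) \<le> C * norm x powr (q - 1)"
        using bd[of x] \<open>x \<noteq> 0\<close> by (simp add: F0 field_simps)
    qed
  qed auto
  then show ?thesis
    by (simp add: has_derivative_iff_norm F0)
qed

text \<open>The gradient of \<open>norm w powr p\<close>. The power is split off as
  \<open>p - 2\<close> so that the factor \<open>w\<close> gives the value 0 at the origin without a
  case distinction.\<close>

definition npow_grad :: "real \<Rightarrow> 'a::real_inner \<Rightarrow> 'a" where
  "npow_grad p w = (p * norm w powr (p - 2)) *\<^sub>R w"

lemma has_derivative_norm_powr_nonzero:
  fixes w :: "'a::real_inner"
  assumes "w \<noteq> 0"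
  shows "((\<lambda>x. norm x powr p) has_derivative (\<lambda>h. npow_grad p w \<bullet> h)) (at w)"
proof -
  have 1: "(norm has_derivative (\<lambda>h. h \<bullet> sgn w)) (at w)"
    using assms by (rule has_derivative_norm)
  have 2: "((\<lambda>y. y powr p) has_field_derivative (p * norm w powr (p - 1))) (at (norm w))"
    using assms by (intro has_real_derivative_powr) simp
  have "((\<lambda>x. norm x powr p) has_derivative (\<lambda>h. (p * norm w powr (p - 1)) * (h \<bullet> sgn w))) (at w)"
    using has_derivative_compose[OF 1 2[unfolded has_field_derivative_def]] by simp
  moreover have "(p * norm w powr (p - 1)) * (h \<bullet> sgn w) = npow_grad p w \<bullet> h" for h
  proof -
    have "norm w powr (p - 1) = norm w powr (p-2) * norm w"
      using assms powr_add[of "norm w" "p-2" 1] by simp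
    then show ?thesis using assms
      by (simp add: npow_grad_def sgn_div_norm inner_commute)
  qed
  ultimately show ?thesis by simp
qed

lemma has_derivative_norm_powr:
  fixes w :: "'a::real_inner"
  assumes "p > 1"
  shows "((\<lambda>x. norm x powr p) has_derivative (\<lambda>h. npow_grad p w \<bullet> h)) (at w)"
proof (cases "w = 0")
  case True
  have "((\<lambda>x. norm x powr p) has_derivative (\<lambda>_. 0)) (at (0::'a))"
    by (rule has_derivative_0_of_powr_bound[OF assms, of _ 1]) simp
  then show ?thesis using True by (simp add: npow_grad_def)
qed (rule has_derivative_norm_powr_nonzero)

text \<open>Away from the origin this is the product rule; at the origin the gradient is of order
  \<open>p - 1\<close>, which exceeds 1 when \<open>p > 2\<close>, so its derivative is 0. The case
  \<open>p = 2\<close> is linear. The bound depends only on \<open>M\<close>, hence is uniform up to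
  and including the zeros.\<close>

lemma npow_grad_derivative:
  fixes w :: "'a::real_inner"
  assumes p: "p \<ge> 2" and M: "norm w \<le> M"
  shows "\<exists>D. (npow_grad p has_derivative D) (at w) \<and>
             (\<forall>h. norm (D h) \<le> (p * (p - 1) * M powr (p - 2) + 2) * norm h)"
proof (cases "p = 2")
  case True
  have eq: "npow_grad p = (\<lambda>x::'a. 2 *\<^sub>R x)"
    using True by (auto simp: npow_grad_def fun_eq_iff)
  have "(npow_grad p has_derivative (\<lambda>h. 2 *\<^sub>R h)) (at w)"
    unfolding eq by (auto intro!: derivative_eq_intros)
  \<comment> \<open>For \<open>M = 0\<close> the term \<open>M powr (p - 2)\<close> is
    \<open>0 powr 0 = 0\<close>, although the derivative has norm 2; the summand \<open>2\<close> in
    the constant covers this.\<close>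
  moreover have "norm (2 *\<^sub>R h) \<le> (p * (p - 1) * M powr (p - 2) + 2) * norm h" for h :: 'a
    using p by (auto simp: distrib_right)
  ultimately show ?thesis by blast
next
  case False
  then have p2: "p > 2" using p by simp
  show ?thesis
  proof (cases "w = 0")
    case True
    have "norm (npow_grad p x) \<le> p * norm x powr (p - 1)" for x :: 'a
      using p powr_add[of "norm x" "p-2" 1] by (cases "x = 0") (auto simp: npow_grad_def)
    then have "(npow_grad p has_derivative (\<lambda>_. 0)) (at (0::'a))"
      using p2 by (intro has_derivative_0_of_powr_bound[of "p - 1" _ p]) auto
    then show ?thesis using True p by (intro exI[of _ "\<lambda>_. 0"]) auto
  next
    case w: False
    define D where "D = (\<lambda>h. (p * norm w powr (p-2)) *\<^sub>R h + (p * (npow_grad (p-2) w \<bullet> h)) *\<^sub>R w)"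
    have "(npow_grad p has_derivative D) (at w)"
      unfolding npow_grad_def[of p, abs_def] D_def
      by (rule derivative_eq_intros has_derivative_norm_powr_nonzero w refl)+ simp
    moreover have "norm (D h) \<le> (p * (p - 1) * M powr (p - 2) + 2) * norm h" for h
    proof -
      \<comment> \<open>The singular power \<open>p - 4\<close> meets one factor
        \<open>norm w\<close> from \<open>npow_grad (p-2) w\<close> and one from the vector
        \<open>w\<close>. Then \<open>p + p * (p - 2) = p * (p - 1)\<close> gives the
        constant.\<close>
      have e: "norm w powr (p-2) = norm w powr (p-4) * norm w * norm w"
        using w powr_add[of "norm w" "p-4" 2] by (simp add: power2_eq_square)
      have "norm (D h) \<le> norm ((p * norm w powr (p-2)) *\<^sub>R h) + norm ((p * (npow_grad (p-2) w \<bullet> h)) *\<^sub>R w)"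
        unfolding D_def by (rule norm_triangle_ineq)
      also have "\<dots> = p * norm w powr (p-2) * norm h + p * (p-2) * norm w powr (p-4) * (\<bar>w \<bullet> h\<bar> * norm w)"
        using p2 by (simp add: npow_grad_def abs_mult)
      also have "\<dots> \<le> p * norm w powr (p-2) * norm h + p * (p-2) * norm w powr (p-4) * ((norm w * norm h) * norm w)"
        using p2 by (intro add_left_mono mult_left_mono mult_right_mono Cauchy_Schwarz_ineq2) auto
      also have "\<dots> = p * (p-1) * norm w powr (p-2) * norm h"
        unfolding e by (simp add: algebra_simps)
      also have "\<dots> \<le> p * (p-1) * M powr (p-2) * norm h"
        using p2 M by (intro mult_right_mono mult_left_mono powr_mono2) auto
      also have "\<dots> \<le> (p * (p - 1) * M powr (p - 2) + 2) * norm h"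
        by (simp add: distrib_right)
      finally show ?thesis .
    qed
    ultimately show ?thesis by blast
  qed
qed

subsection \<open>Integrals over shells\<close>

lemma nn_integral_lborel_scale:
  fixes F :: "'a::euclidean_space \<Rightarrow> ennreal"
  assumes [measurable]: "F \<in> borel_measurable borel" and "c > 0"
  shows "(\<integral>\<^sup>+x. F x \<partial>lborel) = ennreal (c ^ DIM('a)) * (\<integral>\<^sup>+x. F (c *\<^sub>R x) \<partial>lborel)"
  using assms(2)
  by (subst lborel_affine[of c 0])
     (simp_all add: nn_integral_density nn_integral_distr nn_integral_cmult)

text \<open>Averaging the dilations w = \<tau> z over 1 \<le> \<tau> \<le> 2 and substituting r = \<tau> norm z replaces
  integration in polar coordinates, at the price of a nonoptimal constant.\<close>
lemma nn_integral_shell_le: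
  fixes U :: "'a::euclidean_space \<Rightarrow> ennreal"
  assumes U[measurable]: "U \<in> borel_measurable borel"
    and C: "\<And>r. 0 < r \<Longrightarrow> r < 1 \<Longrightarrow>
        (\<integral>\<^sup>+z. U (r *\<^sub>R (z /\<^sub>R norm z)) * indicator (ball 0 1) z \<partial>lborel) \<le> C"
    and ab: "1/2 \<le> \<alpha>" "\<alpha> \<le> \<beta>" "\<beta> < 1"
  shows "(\<integral>\<^sup>+w. U w * indicator {w. \<alpha> \<le> norm w \<and> norm w \<le> \<beta>} w \<partial>lborel)
      \<le> ennreal (4 * 2 ^ DIM('a)) * (ennreal (\<beta> - \<alpha>) * C)" (is "?I \<le> _")
proof -
  define F where "F w = U w * indicator {w. \<alpha> \<le> norm w \<and> norm w \<le> \<beta>} w" for w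
  have S[measurable]: "{w::'a. \<alpha> \<le> norm w \<and> norm w \<le> \<beta>} \<in> sets borel" by measurable
  have [measurable]: "Measurable.pred borel (\<lambda>z::'a. z \<in> ball 0 1)" by simp
  have F[measurable]: "F \<in> borel_measurable borel" unfolding F_def by measurable
  define T where "T = (\<lambda>\<tau>. indicator {1..2::real} \<tau> :: ennreal)"
  have T[measurable]: "T \<in> borel_measurable borel" unfolding T_def by measurable
  \<comment> \<open>On the support, \<alpha> \<ge> 1/2 and \<tau> \<le> 2 force
    \<open>norm z\<close> \<ge> 1/4, so the Jacobian \<open>1 / norm z\<close> is at most 4; \<tau>
    \<ge> 1 and \<beta> < 1 force \<open>norm z < 1\<close>, which produces the indicator of the
    unit ball.\<close>
  have inner: "(\<integral>\<^sup>+\<tau>. T \<tau> * F (\<tau> *\<^sub>R z) \<partial>lborel)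
      \<le> 4 * (\<integral>\<^sup>+r. indicator {\<alpha>..\<beta>} r * (U (r *\<^sub>R (z /\<^sub>R norm z)) * indicator (ball 0 1) z) \<partial>lborel)" for z :: 'a
  proof (cases "1/4 \<le> norm z \<and> norm z < 1")
    case True
    then have z: "norm z > 0" by linarith
    have "(\<integral>\<^sup>+\<tau>. T \<tau> * F (\<tau> *\<^sub>R z) \<partial>lborel) = 
        ennreal (1 / norm z) * (\<integral>\<^sup>+r. T (r / norm z) * F (r *\<^sub>R (z /\<^sub>R norm z)) \<partial>lborel)"
      using z by (subst nn_integral_real_affine[where c="1 / norm z" and t=0]) (auto simp: field_simps)
    also have "\<dots> \<le> 4 * (\<integral>\<^sup>+r. indicator {\<alpha>..\<beta>} r * (U (r *\<^sub>R (z /\<^sub>R norm z)) * indicator (ball 0 1) z) \<partial>lborel)"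
    proof (rule mult_mono[OF _ nn_integral_mono])
      have "1 / norm z \<le> 4" using True z by (auto simp: field_simps)
      then show "ennreal (1 / norm z) \<le> 4" by (metis ennreal_leI ennreal_numeral zero_le_numeral)
      fix r :: real
      show "T (r / norm z) * F (r *\<^sub>R (z /\<^sub>R norm z))
          \<le> indicator {\<alpha>..\<beta>} r * (U (r *\<^sub>R (z /\<^sub>R norm z)) * indicator (ball 0 1) z)"
      proof (cases "r > 0")
        case True
        define y where "y = r *\<^sub>R (z /\<^sub>R norm z)"
        have "norm y = r" using True z by (simp add: y_def)
        then show ?thesis using \<open>1/4 \<le> norm z \<and> norm z < 1\<close>
          unfolding y_def[symmetric] by (auto simp: F_def T_def indicator_def)
      next
        case False
        then have "r / norm z \<le> 0" using z by (simp add: divide_nonpos_pos)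
        then have "T (r / norm z) = 0" by (auto simp: T_def indicator_def)
        then show ?thesis by simp
      qed
    qed auto
    finally show ?thesis .
  next
    case False
    have zero: "T \<tau> * F (\<tau> *\<^sub>R z) = 0" for \<tau>
    proof (rule ccontr)
      assume "\<not> ?thesis"
      then have t: "1 \<le> \<tau>" "\<tau> \<le> 2" and a: "\<alpha> \<le> \<tau> * norm z" "\<tau> * norm z \<le> \<beta>"
        by (auto simp: T_def F_def indicator_def split: if_splits)
      have "1 * norm z \<le> \<tau> * norm z" "\<tau> * norm z \<le> 2 * norm z"
        using t by (intro mult_right_mono; simp)+
      then show False using False a ab by auto
    qed
    show ?thesis unfolding zero by simp
  qed
  \<comment> \<open>The interval [1, 2] has length 1, so averaging over it leaves the integral
    unchanged.\<close>
  have "?I = (\<integral>\<^sup>+w. F w \<partial>lborel) * (\<integral>\<^sup>+\<tau>. T \<tau> \<partial>lborel)"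
    unfolding T_def F_def by simp
  also have "\<dots> = (\<integral>\<^sup>+\<tau>. T \<tau> * (\<integral>\<^sup>+w. F w \<partial>lborel) \<partial>lborel)"
    by (simp add: nn_integral_multc mult.commute)
  also have "\<dots> \<le> (\<integral>\<^sup>+\<tau>. ennreal (2 ^ DIM('a)) * (\<integral>\<^sup>+z. T \<tau> * F (\<tau> *\<^sub>R z) \<partial>lborel) \<partial>lborel)"
  proof (rule nn_integral_mono)
    fix \<tau> :: real
    show "T \<tau> * (\<integral>\<^sup>+w. F w \<partial>lborel) \<le> ennreal (2 ^ DIM('a)) * (\<integral>\<^sup>+z. T \<tau> * F (\<tau> *\<^sub>R z) \<partial>lborel)"
    proof (cases "1 \<le> \<tau> \<and> \<tau> \<le> 2")
      case True
      then have "(\<integral>\<^sup>+w. F w \<partial>lborel) = ennreal (\<tau> ^ DIM('a)) * (\<integral>\<^sup>+x. F (\<tau> *\<^sub>R x) \<partial>lborel)"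
        by (intro nn_integral_lborel_scale) auto
      also have "\<dots> \<le> ennreal (2 ^ DIM('a)) * (\<integral>\<^sup>+x. F (\<tau> *\<^sub>R x) \<partial>lborel)"
        using True by (intro mult_right_mono ennreal_leI power_mono) auto
      finally show ?thesis using True by (simp add: T_def)
    qed (simp add: T_def)
  qed
  also have "\<dots> = ennreal (2 ^ DIM('a)) * (\<integral>\<^sup>+\<tau>. \<integral>\<^sup>+z. T \<tau> * F (\<tau> *\<^sub>R z) \<partial>lborel \<partial>lborel)"
    by (rule nn_integral_cmult) measurable
  also have "(\<integral>\<^sup>+\<tau>. \<integral>\<^sup>+z. T \<tau> * F (\<tau> *\<^sub>R z) \<partial>lborel \<partial>lborel) = (\<integral>\<^sup>+z. \<integral>\<^sup>+\<tau>. T \<tau> * F (\<tau> *\<^sub>R z) \<partial>lborel \<partial>lborel)"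
    by (rule lborel_pair.Fubini') measurable
  also have "\<dots> \<le> (\<integral>\<^sup>+z. 4 * (\<integral>\<^sup>+r. indicator {\<alpha>..\<beta>} r * (U (r *\<^sub>R (z /\<^sub>R norm z)) * indicator (ball 0 1) z) \<partial>lborel) \<partial>lborel)"
    by (rule nn_integral_mono) (rule inner)
  also have "\<dots> = 4 * (\<integral>\<^sup>+z. \<integral>\<^sup>+r. indicator {\<alpha>..\<beta>} r * (U (r *\<^sub>R (z /\<^sub>R norm z)) * indicator (ball 0 1) z) \<partial>lborel \<partial>lborel)"
    by (rule nn_integral_cmult) measurable
  also have "(\<integral>\<^sup>+z. \<integral>\<^sup>+r. indicator {\<alpha>..\<beta>} r * (U (r *\<^sub>R (z /\<^sub>R norm z)) * indicator (ball 0 1) z) \<partial>lborel \<partial>lborel)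
      = (\<integral>\<^sup>+r. \<integral>\<^sup>+z. indicator {\<alpha>..\<beta>} r * (U (r *\<^sub>R (z /\<^sub>R norm z)) * indicator (ball 0 1) z) \<partial>lborel \<partial>lborel)"
    by (rule lborel_pair.Fubini') measurable
  also have "\<dots> \<le> (\<integral>\<^sup>+r. C * indicator {\<alpha>..\<beta>} r \<partial>lborel)"
  proof (rule nn_integral_mono)
    fix r :: real
    show "(\<integral>\<^sup>+z. indicator {\<alpha>..\<beta>} r * (U (r *\<^sub>R (z /\<^sub>R norm z)) * indicator (ball 0 1) z) \<partial>lborel) \<le> C * indicator {\<alpha>..\<beta>} r"
      using C[of r] ab by (auto simp: indicator_def)
  qed
  also have "\<dots> = C * ennreal (\<beta> - \<alpha>)"
    using ab by (subst nn_integral_cmult_indicator) auto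
  finally have "?I \<le> ennreal (2 ^ DIM('a)) * (4 * (C * ennreal (\<beta> - \<alpha>)))"
    by (simp add: mult_left_mono)
  also have "\<dots> = ennreal (4 * 2 ^ DIM('a)) * (ennreal (\<beta> - \<alpha>) * C)"
    by (simp add: ennreal_mult mult_ac)
  finally show ?thesis .
qed

subsection \<open>The cutoff function\<close>

text \<open>A second difference with step e of the cubic truncated power, scaled so that the second
  derivative is a tent of mass 1 supported in [0, 2e]; hence ramp e t = t - e for t \<ge> 2e.\<close>
definition ramp :: "real \<Rightarrow> real \<Rightarrow> real" where
  "ramp e t = (max 0 t ^ 3 - 2 * max 0 (t - e) ^ 3 + max 0 (t - 2 * e) ^ 3) / (6 * e\<^sup>2)"
definition ramp' :: "real \<Rightarrow> real \<Rightarrow> real" where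
  "ramp' e t = (max 0 t ^ 2 - 2 * max 0 (t - e) ^ 2 + max 0 (t - 2 * e) ^ 2) / (2 * e\<^sup>2)"
definition ramp'' :: "real \<Rightarrow> real \<Rightarrow> real" where
  "ramp'' e t = (max 0 t - 2 * max 0 (t - e) + max 0 (t - 2 * e)) / e\<^sup>2"

text \<open>The delicate point is \<open>t = 0\<close>: there the difference quotient is
  \<open>max 0 h ^ n\<close>, which tends to 0 because \<open>n\<close> \<ge> 1.\<close>

lemma DERIV_max0_power:
  assumes "n \<ge> 1"
  shows "((\<lambda>t. max 0 t ^ Suc n) has_real_derivative real (Suc n) * max 0 t ^ n) (at (t::real))"
proof -
  consider "t > 0" | "t < 0" | "t = 0" by linarith
  then show ?thesis
  proof cases
    case 1
    have "((\<lambda>t. t ^ Suc n) has_real_derivative real (Suc n) * max 0 t ^ n) (at t)"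
      using 1 DERIV_pow[of "Suc n" t UNIV] by simp
    moreover have "\<forall>\<^sub>F x in nhds t. max 0 x ^ Suc n = x ^ Suc n"
      using eventually_nhds_in_open[of "{0<..}" t] 1 by (auto elim!: eventually_mono)
    ultimately show ?thesis by (subst DERIV_cong_ev[OF refl _ refl])
  next
    case 2
    have "((\<lambda>t. 0) has_real_derivative real (Suc n) * max 0 t ^ n) (at t)"
      using 2 assms by (auto intro!: derivative_eq_intros)
    moreover have "\<forall>\<^sub>F x in nhds t. max 0 x ^ Suc n = 0"
      using eventually_nhds_in_open[of "{..<0}" t] 2 by (auto elim!: eventually_mono)
    ultimately show ?thesis by (subst DERIV_cong_ev[OF refl _ refl])
  next
    case 3
    have "((\<lambda>h. max 0 h ^ n) \<longlongrightarrow> max 0 0 ^ n) (at (0::real))"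
      by (intro tendsto_intros)
    moreover have "(max 0 (0 + h) ^ Suc n - max 0 0 ^ Suc n) / h = max 0 h ^ n" if "h \<noteq> 0" for h :: real
      using assms that by (auto simp: max_def)
    ultimately show ?thesis using 3 assms
      unfolding DERIV_def by (subst LIM_equal[where g = "\<lambda>h. max 0 h ^ n"]) (auto simp: power_0_left)
  qed
qed

lemma DERIV_ramp: assumes "e > 0" shows "(ramp e has_real_derivative ramp' e t) (at t)"
proof -
  have d: "((\<lambda>t. t - a) has_real_derivative 1) (at t)" for a
    by (auto intro!: derivative_eq_intros)
  have 1: "((\<lambda>t. max 0 (t - a) ^ 3) has_real_derivative 3 * max 0 (t - a) ^ 2) (at t)" for a
    using DERIV_chain'[of "\<lambda>t. t - a" 1 t UNIV, OF d DERIV_max0_power[of 2 "t - a"]]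
    by (simp add: eval_nat_numeral)
  have "(ramp e has_real_derivative (3 * max 0 t ^ 2 - 2 * (3 * max 0 (t - e) ^ 2) + 3 * max 0 (t - 2 * e) ^ 2) / (6 * e\<^sup>2)) (at t)"
    unfolding ramp_def[abs_def]
    by (intro DERIV_cdivide DERIV_add DERIV_diff DERIV_cmult 1 1[of 0, simplified])
  moreover have "(3 * max 0 t ^ 2 - 2 * (3 * max 0 (t - e) ^ 2) + 3 * max 0 (t - 2 * e) ^ 2) / (6 * e\<^sup>2) = ramp' e t"
    using assms by (simp add: ramp'_def field_simps)
  ultimately show ?thesis by simp
qed

lemma DERIV_ramp': assumes "e > 0" shows "(ramp' e has_real_derivative ramp'' e t) (at t)"
proof -
  have d: "((\<lambda>t. t - a) has_real_derivative 1) (at t)" for a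
    by (auto intro!: derivative_eq_intros)
  have 1: "((\<lambda>t. max 0 (t - a) ^ 2) has_real_derivative 2 * max 0 (t - a)) (at t)" for a
    using DERIV_chain'[of "\<lambda>t. t - a" 1 t UNIV, OF d DERIV_max0_power[of 1 "t - a"]]
    by (simp add: eval_nat_numeral)
  have "(ramp' e has_real_derivative (2 * max 0 t - 2 * (2 * max 0 (t - e)) + 2 * max 0 (t - 2 * e)) / (2 * e\<^sup>2)) (at t)"
    unfolding ramp'_def[abs_def]
    by (intro DERIV_cdivide DERIV_add DERIV_diff DERIV_cmult 1 1[of 0, simplified])
  moreover have "(2 * max 0 t - 2 * (2 * max 0 (t - e)) + 2 * max 0 (t - 2 * e)) / (2 * e\<^sup>2) = ramp'' e t"
    using assms by (simp add: ramp''_def field_simps)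
  ultimately show ?thesis by simp
qed

lemma ramp_zero:
  assumes "e > 0" "t \<le> 0"
  shows "ramp e t = 0" "ramp' e t = 0" "ramp'' e t = 0"
  using assms by (simp_all add: ramp_def ramp'_def ramp''_def)

text \<open>The tent has its peak \<open>1 / e\<close> at \<open>t = e\<close>.\<close>

lemma ramp''_le:
  assumes "e > 0"
  shows "ramp'' e t \<le> indicator {0..2*e} t / e"
proof -
  consider "t < 0" | "0 \<le> t" "t \<le> e" | "e \<le> t" "t \<le> 2 * e" | "2 * e < t" by linarith
  then show ?thesis
    using assms by cases (auto simp: ramp''_def indicator_def divide_simps power2_eq_square)
qed

text \<open>The sign allows the first-order term of Delta \<phi>, which enters with a minus, to be
  dropped from an upper bound.\<close>

lemma ramp'_nonneg:
  assumes "e > 0" shows "ramp' e t \<ge> 0"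
proof -
  consider "t \<le> 0" | "0 \<le> t" "t \<le> e" | "e \<le> t" "t \<le> 2 * e" | "2 * e < t" by linarith
  then have "max 0 t ^ 2 - 2 * max 0 (t - e) ^ 2 + max 0 (t - 2 * e) ^ 2 \<ge> 0"
  proof cases
    case 3
    have "(t - e)\<^sup>2 \<le> e\<^sup>2" using 3 by (intro power_mono) auto
    moreover have "t\<^sup>2 = (t-e)\<^sup>2 + 2 * e * (t - e) + e\<^sup>2" by (simp add: power2_eq_square algebra_simps)
    moreover have "2 * e * (t - e) \<ge> 0" using 3 assms by simp
    ultimately have "t\<^sup>2 - 2 * (t-e)\<^sup>2 \<ge> 0" by linarith
    then show ?thesis using 3 assms by auto
  next
    case 4
    have "t\<^sup>2 - 2 * (t-e)\<^sup>2 + (t - 2 * e)\<^sup>2 = 2 * e\<^sup>2" by (simp add: power2_eq_square algebra_simps)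
    then show ?thesis using 4 assms by auto
  qed (use assms in auto)
  then show ?thesis using assms by (simp add: ramp'_def)
qed

text \<open>The convex function \<open>ramp e\<close> lies above the line \<open>t - e\<close>, with
  which it coincides from \<open>2 * e\<close> on. Between \<open>e\<close> and \<open>2 * e\<close>
  the gap, multiplied by \<open>6 * e\<^sup>2\<close>, is the cube
  \<open>(2 * e - t) ^ 3\<close>.\<close>

lemma ramp_ge:
  assumes e: "e > 0" shows "max 0 (t - e) \<le> ramp e t"
proof -
  consider "t \<le> e" | "e \<le> t" "t \<le> 2 * e" | "2 * e < t" by linarith
  then have "6 * e\<^sup>2 * max 0 (t - e) \<le> max 0 t ^ 3 - 2 * max 0 (t - e) ^ 3 + max 0 (t - 2 * e) ^ 3"
  proof cases
    case 2
    have "t ^ 3 - 2 * (t-e) ^ 3 - 6 * e\<^sup>2 * (t - e) = (2 * e - t) ^ 3"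
      by (simp add: power2_eq_square power3_eq_cube algebra_simps)
    moreover have "(2 * e - t) ^ 3 \<ge> 0" using 2 by simp
    moreover have "max 0 t = t" "max 0 (t - e) = t - e" "max 0 (t - 2 * e) = 0" using 2 e by auto
    ultimately show ?thesis by (simp only: power_zero_numeral)
  next
    case 3
    have "t ^ 3 - 2 * (t-e) ^ 3 + (t - 2 * e) ^ 3 = 6 * e\<^sup>2 * (t - e)"
      by (simp add: power2_eq_square power3_eq_cube algebra_simps)
    then show ?thesis using 3 e by auto
  qed (use e in auto)
  then have "max 0 (t - e) * (6 * e\<^sup>2) \<le> max 0 t ^ 3 - 2 * max 0 (t - e) ^ 3 + max 0 (t - 2 * e) ^ 3"
    by (simp only: mult.commute[of "6 * e\<^sup>2"])
  then show ?thesis using e unfolding ramp_def by (subst pos_le_divide_eq) simp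
qed

subsection \<open>Regularity of powers of a function\<close>

text \<open>Exactly the regularity that the integration by parts consumes: pure second derivatives
  that exist and are bounded on smaller closed balls. With bounds in place of continuity, size
  estimates suffice at the zeros of \<open>f\<close>.\<close>

definition lap_regular :: "(complex^'n \<Rightarrow> real) \<Rightarrow> bool" where
  "lap_regular u \<longleftrightarrow> (\<forall>z\<in>unit_ball. u differentiable (at z)) \<and>
     (\<forall>v\<in>Basis. (\<forall>z\<in>unit_ball. pderiv_dir u v differentiable (at z)) \<and>
        (\<forall>\<rho><1. \<exists>M. \<forall>z\<in>cball 0 \<rho>. \<bar>pderiv_dir (pderiv_dir u v) v z\<bar> \<le> M))"

lemma pderiv_dir_eq:
  "(f has_derivative f') (at z) \<Longrightarrow> pderiv_dir f v z = f' v"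
  unfolding pderiv_dir_def using frechet_derivative_at by metis

lemma continuous_on_compact_bound_norm:
  fixes f :: "'a::topological_space \<Rightarrow> 'b::real_normed_vector"
  assumes "compact S" "continuous_on S f"
  obtains M where "M \<ge> 0" "\<And>z. z \<in> S \<Longrightarrow> norm (f z) \<le> M"
proof -
  have "bounded (f ` S)" using assms compact_continuous_image compact_imp_bounded by blast
  then obtain M where "\<forall>x\<in>f ` S. norm x \<le> M" unfolding bounded_iff by blast
  then show thesis by (intro that[of "max 0 M"]) (auto simp: le_max_iff_disj)
qed

lemma C2_on_continuous:
  assumes "C2_on S f"
  shows "continuous_on S f" and "v \<in> Basis \<Longrightarrow> continuous_on S (pderiv_dir f v)"
  using assms unfolding C2_on_def
  by (auto intro!: continuous_at_imp_continuous_on differentiable_imp_continuous_within)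

text \<open>The chain rule, applied twice, writes the second derivative in direction
  \<open>v\<close> as the gradient of the power paired with the second derivative of
  \<open>f\<close>, plus the Hessian of the power evaluated on the first derivative of
  \<open>f\<close>. Each factor is bounded on a compact ball.\<close>

lemma lap_regular_norm_powr:
  fixes f :: "complex^'n \<Rightarrow> complex"
  assumes f: "C2_on unit_ball f" and p: "p \<ge> 2"
  shows "lap_regular (\<lambda>w. cmod (f w) powr p)"
proof -
  define u where "u = (\<lambda>w. cmod (f w) powr p)"
  have u1: "(u has_derivative (\<lambda>h. npow_grad p (f z) \<bullet> frechet_derivative f (at z) h)) (at z)"
    if "z \<in> unit_ball" for z
  proof -
    have "(f has_derivative frechet_derivative f (at z)) (at z)"
      using f that unfolding C2_on_def by (simp add: frechet_derivative_works)
    from has_derivative_compose[OF this has_derivative_norm_powr[of p "f z"]] p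
    show ?thesis unfolding u_def by simp
  qed
  have u1e: "pderiv_dir u v z = npow_grad p (f z) \<bullet> pderiv_dir f v z" if "z \<in> unit_ball" for v z
    using pderiv_dir_eq[OF u1[OF that]] by (simp add: pderiv_dir_def)
  \<comment> \<open>\<open>M\<close> is left free: \<open>norm (f z)\<close> serves for
    differentiability at a single point, a maximum over a closed ball for the uniform bound.\<close>
  have u2: "\<exists>D. (pderiv_dir u v has_derivative D) (at z) \<and>
      \<bar>D v\<bar> \<le> p * M powr (p - 2) * M * norm (pderiv_dir (pderiv_dir f v) v z)
         + (p * (p - 1) * M powr (p - 2) + 2) * norm (pderiv_dir f v z) * norm (pderiv_dir f v z)"
    if z: "z \<in> unit_ball" and v: "v \<in> Basis" and M: "norm (f z) \<le> M" for v z M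
  proof -
    have d1: "(f has_derivative frechet_derivative f (at z)) (at z)"
      and d2: "(pderiv_dir f v has_derivative frechet_derivative (pderiv_dir f v) (at z)) (at z)"
      using f z v unfolding C2_on_def by (simp_all add: frechet_derivative_works)
    obtain E where E: "(npow_grad p has_derivative E) (at (f z))"
      and Eb: "\<And>h. norm (E h) \<le> (p * (p - 1) * M powr (p - 2) + 2) * norm h"
      using npow_grad_derivative[OF p M] by blast
    define D where "D h = npow_grad p (f z) \<bullet> frechet_derivative (pderiv_dir f v) (at z) h
        + E (frechet_derivative f (at z) h) \<bullet> pderiv_dir f v z" for h
    have "((\<lambda>w. npow_grad p (f w) \<bullet> pderiv_dir f v w) has_derivative D) (at z)"
      unfolding D_def[abs_def]
      by (rule has_derivative_inner[OF has_derivative_compose[OF d1 E] d2])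
    then have "(pderiv_dir u v has_derivative D) (at z)"
      by (rule has_derivative_transform_within_open[OF _ open_ball z]) (simp add: u1e)
    moreover have "\<bar>D v\<bar> \<le> p * M powr (p - 2) * M * norm (pderiv_dir (pderiv_dir f v) v z)
         + (p * (p - 1) * M powr (p - 2) + 2) * norm (pderiv_dir f v z) * norm (pderiv_dir f v z)"
    proof -
      have D: "D v = npow_grad p (f z) \<bullet> pderiv_dir (pderiv_dir f v) v z + E (pderiv_dir f v z) \<bullet> pderiv_dir f v z"
        by (simp add: D_def pderiv_dir_def)
      have "\<bar>npow_grad p (f z) \<bullet> pderiv_dir (pderiv_dir f v) v z\<bar>
          \<le> norm (npow_grad p (f z)) * norm (pderiv_dir (pderiv_dir f v) v z)"
        by (rule Cauchy_Schwarz_ineq2)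
      also have "\<dots> \<le> (p * M powr (p - 2) * M) * norm (pderiv_dir (pderiv_dir f v) v z)"
        unfolding npow_grad_def norm_scaleR abs_mult
        using M p by (intro mult_right_mono mult_mono) (auto intro!: powr_mono2)
      finally have 1: "\<bar>npow_grad p (f z) \<bullet> pderiv_dir (pderiv_dir f v) v z\<bar> \<le> \<dots>" .
      have "\<bar>E (pderiv_dir f v z) \<bullet> pderiv_dir f v z\<bar> \<le> norm (E (pderiv_dir f v z)) * norm (pderiv_dir f v z)"
        by (rule Cauchy_Schwarz_ineq2)
      also have "\<dots> \<le> (p * (p - 1) * M powr (p - 2) + 2) * norm (pderiv_dir f v z) * norm (pderiv_dir f v z)"
        by (intro mult_right_mono Eb) auto
      finally show ?thesis unfolding D using 1 by linarith
    qed
    ultimately show ?thesis by blast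
  qed
  have "lap_regular u"
    unfolding lap_regular_def
  proof (intro conjI ballI allI impI)
    fix z :: "complex^'n" assume "z \<in> unit_ball"
    then show "u differentiable at z" using u1 by (auto simp: differentiable_def)
  next
    fix v z :: "complex^'n" assume "v \<in> Basis" "z \<in> unit_ball"
    then show "pderiv_dir u v differentiable at z" using u2[of z v "norm (f z)"] by (auto simp: differentiable_def)
  next
    fix v :: "complex^'n" and \<rho> :: real assume v: "v \<in> Basis" and \<rho>: "\<rho> < 1"
    have sub: "cball 0 \<rho> \<subseteq> (unit_ball :: (complex^'n) set)" using \<rho> by auto
    have c: "continuous_on (cball 0 \<rho>) f" "continuous_on (cball 0 \<rho>) (pderiv_dir f v)"
       "continuous_on (cball 0 \<rho>) (pderiv_dir (pderiv_dir f v) v)"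
      using C2_on_continuous[OF f] v f[unfolded C2_on_def] continuous_on_subset[OF _ sub] by blast+
    obtain M where M: "M \<ge> 0" "\<And>z. z \<in> cball 0 \<rho> \<Longrightarrow> norm (f z) \<le> M"
      using continuous_on_compact_bound_norm[OF compact_cball c(1)] by metis
    obtain M1 where M1: "M1 \<ge> 0" "\<And>z. z \<in> cball 0 \<rho> \<Longrightarrow> norm (pderiv_dir f v z) \<le> M1"
      using continuous_on_compact_bound_norm[OF compact_cball c(2)] by metis
    obtain M2 where M2: "M2 \<ge> 0" "\<And>z. z \<in> cball 0 \<rho> \<Longrightarrow> norm (pderiv_dir (pderiv_dir f v) v z) \<le> M2"
      using continuous_on_compact_bound_norm[OF compact_cball c(3)] by metis
    show "\<exists>B. \<forall>z\<in>cball 0 \<rho>. \<bar>pderiv_dir (pderiv_dir u v) v z\<bar> \<le> B"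
    proof (intro exI ballI)
      fix z :: "complex^'n" assume z: "z \<in> cball 0 \<rho>"
      then obtain D where D: "(pderiv_dir u v has_derivative D) (at z)" and
        b: "\<bar>D v\<bar> \<le> p * M powr (p - 2) * M * norm (pderiv_dir (pderiv_dir f v) v z)
         + (p * (p - 1) * M powr (p - 2) + 2) * norm (pderiv_dir f v z) * norm (pderiv_dir f v z)"
        using u2[OF _ v M(2)[OF z]] sub by blast
      note b
      also have "\<dots> \<le> p * M powr (p - 2) * M * M2 + (p * (p - 1) * M powr (p - 2) + 2) * M1 * M1"
      proof (intro add_mono)
        show "p * M powr (p - 2) * M * norm (pderiv_dir (pderiv_dir f v) v z) \<le> p * M powr (p - 2) * M * M2"
          using p M(1) M2(2)[OF z] by (intro mult_left_mono) auto
        have K: "0 \<le> p * (p - 1) * M powr (p - 2) + 2" using p by simp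
        show "(p * (p - 1) * M powr (p - 2) + 2) * norm (pderiv_dir f v z) * norm (pderiv_dir f v z)
          \<le> (p * (p - 1) * M powr (p - 2) + 2) * M1 * M1"
          using K M1(1) M1(2)[OF z] by (intro mult_mono mult_left_mono) simp_all
      qed
      finally show "\<bar>pderiv_dir (pderiv_dir u v) v z\<bar> \<le> p * M powr (p - 2) * M * M2 + (p * (p - 1) * M powr (p - 2) + 2) * M1 * M1"
        by (simp add: pderiv_dir_eq[OF D])
    qed
  qed
  then show ?thesis unfolding u_def .
qed

subsection \<open>Integration by parts\<close>

text \<open>By translation invariance the difference quotients have integral 0.\<close>
lemma integral_directional_derivative_compact_support:
  fixes G G' :: "'a::euclidean_space \<Rightarrow> real"
  assumes Gi: "integrable lborel G"
    and der: "\<And>z. ((\<lambda>t. G (z + t *\<^sub>R v)) has_real_derivative G' z) (at 0)"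
    and bd: "\<And>z. \<bar>G' z\<bar> \<le> M"
    and supp: "\<And>z. norm z > R \<Longrightarrow> G z = 0"
  shows "integrable lborel G'" and "(\<integral>z. G' z \<partial>lborel) = 0"
proof -
  have M0: "M \<ge> 0" using bd[of 0] by (meson abs_ge_zero order_trans)
  have der': "((\<lambda>t. G (z + t *\<^sub>R v)) has_real_derivative G' (z + s *\<^sub>R v)) (at s)" for z s
  proof -
    have "((\<lambda>t. G ((z + s *\<^sub>R v) + t *\<^sub>R v)) has_real_derivative G' (z + s *\<^sub>R v)) (at 0)"
      by (rule der)
    then have "((\<lambda>t. G (z + (t + s) *\<^sub>R v)) has_real_derivative G' (z + s *\<^sub>R v)) (at 0)"
      by (simp add: algebra_simps)
    then show ?thesis using DERIV_shift[of "\<lambda>t. G (z + t *\<^sub>R v)" _ 0 s] by simp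
  qed
  \<comment> \<open>The mean value theorem along the line turns the bound on \<open>G'\<close> into
    a bound on all difference quotients.\<close>
  have lip: "\<bar>G (z + s *\<^sub>R v) - G z\<bar> \<le> M * s" if "s > 0" for z s
  proof -
    have "\<exists>x>0. x < s \<and> G (z + s *\<^sub>R v) - G (z + 0 *\<^sub>R v) = (s - 0) * G' (z + x *\<^sub>R v)"
      by (rule MVT2[OF that]) (rule der')
    then obtain x where "G (z + s *\<^sub>R v) - G (z + 0 *\<^sub>R v) = (s - 0) * G' (z + x *\<^sub>R v)"
      by blast
    then show ?thesis using that bd[of "z + x *\<^sub>R v"] by (simp add: abs_mult mult.commute)
  qed
  define h where "h n = inverse (real (Suc n))" for n
  have h0: "h n > 0" "h n \<le> 1" for n by (simp_all add: h_def divide_simps)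
  define Q where "Q n z = (G (z + h n *\<^sub>R v) - G z) / h n" for n z
  \<comment> \<open>Since \<open>h n\<close> \<le> 1, every quotient is supported in the ball of
    radius \<open>R + norm v\<close>, so one integrable majorant serves all
    \<open>n\<close>.\<close>
  define W where "W z = M * indicator (cball 0 (R + norm v)) z" for z :: 'a
  have lim: "(\<lambda>n. Q n z) \<longlonglongrightarrow> G' z" for z
  proof -
    have "((\<lambda>t. (G (z + t *\<^sub>R v) - G z) / t) \<longlongrightarrow> G' z) (at 0)"
      using der[of z] by (simp add: DERIV_def)
    moreover have "filterlim h (at 0) sequentially"
      unfolding filterlim_at using LIMSEQ_inverse_real_of_nat h0(1)
      by (auto simp: h_def[abs_def] intro!: always_eventually)
    ultimately show ?thesis
      unfolding Q_def by (rule filterlim_compose)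
  qed
  have Qm[measurable]: "Q n \<in> borel_measurable lborel" for n
    unfolding Q_def[abs_def] using borel_measurable_integrable[OF Gi] by measurable
  \<comment> \<open>Measurability of \<open>G'\<close> is not assumed; it is inherited from the
    quotients in the limit.\<close>
  have G'm: "G' \<in> borel_measurable lborel"
    by (rule borel_measurable_LIMSEQ_real[OF lim]) (rule Qm)
  have Wi: "integrable lborel W"
    unfolding W_def by (intro integrable_mult_right integrable_real_indicator emeasure_bounded_finite) auto
  have QW: "norm (Q n z) \<le> W z" for n z
  proof (cases "norm z \<le> R + norm v")
    case True
    then show ?thesis using lip[OF h0(1)[of n], of z] h0(1)[of n]
      by (simp add: Q_def W_def field_simps)
  next
    case False
    have "norm (h n *\<^sub>R v) \<le> norm v" using h0[of n] by (simp add: mult_left_le_one_le)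
    then have "norm (z + h n *\<^sub>R v) > R" 
      using False norm_diff_ineq[of z "h n *\<^sub>R v"] by linarith
    moreover have "norm z > R" using False norm_ge_zero[of v] by linarith
    ultimately show ?thesis using False M0 by (simp add: Q_def W_def supp)
  qed
  show "integrable lborel G'"
    by (rule integrable_dominated_convergence[OF G'm _ Wi, of Q]) (auto simp: lim QW[unfolded real_norm_def])
  have conv: "(\<lambda>n. \<integral>z. Q n z \<partial>lborel) \<longlonglongrightarrow> (\<integral>z. G' z \<partial>lborel)"
    by (rule integral_dominated_convergence[OF G'm _ Wi]) (auto simp: lim QW[unfolded real_norm_def])
  have "(\<integral>z. Q n z \<partial>lborel) = 0" for n
  proof -
    have t: "integrable lborel (\<lambda>z. G (h n *\<^sub>R v + z))" "(\<integral>z. G (h n *\<^sub>R v + z) \<partial>lborel) = (\<integral>z. G z \<partial>lborel)"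
      using Gi integrable_distr_eq[of "(+) (h n *\<^sub>R v)" lborel borel G]
        integral_distr[of "(+) (h n *\<^sub>R v)" lborel borel G]
      by (simp_all add: lborel_distr_plus)
    show ?thesis unfolding Q_def using t Gi by (simp add: add.commute)
  qed
  then show "(\<integral>z. G' z \<partial>lborel) = 0" using conv by (simp add: LIMSEQ_const_iff)
qed

lemma has_real_derivative_line:
  assumes "u differentiable (at z)"
  shows "((\<lambda>t. u (z + t *\<^sub>R v)) has_real_derivative pderiv_dir u v z) (at 0)"
proof -
  have d: "(u has_derivative frechet_derivative u (at z)) (at (z + 0 *\<^sub>R v))"
    using assms by (simp add: frechet_derivative_works)
  have "((\<lambda>t. z + t *\<^sub>R v) has_derivative (\<lambda>t. t *\<^sub>R v)) (at 0)"
    by (auto intro!: derivative_eq_intros)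
  from has_derivative_compose[OF this d]
  have "((\<lambda>t. u (z + t *\<^sub>R v)) has_derivative (\<lambda>t. frechet_derivative u (at z) (t *\<^sub>R v))) (at 0)" .
  moreover have "frechet_derivative u (at z) (t *\<^sub>R v) = t * pderiv_dir u v z" for t
    using assms linear_frechet_derivative[OF assms] by (simp add: pderiv_dir_def linear_scale)
  ultimately show ?thesis by (simp add: has_field_derivative_def mult_commute_abs)
qed

text \<open>Green's identity in one direction. The field \<open>G\<close> = \<phi> u_v - u \<phi>_v
  has derivative \<phi> u_vv - u \<phi>_vv because the mixed products cancel. It is compactly
  supported in the ball, so the integral of this derivative vanishes.\<close>

lemma integral_second_directional_by_parts:
  fixes u :: "complex^'n \<Rightarrow> real"
  assumes d1: "\<And>z. z \<in> unit_ball \<Longrightarrow> u differentiable (at z)"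
    and d2: "\<And>z. z \<in> unit_ball \<Longrightarrow> pderiv_dir u v differentiable (at z)"
    and bd: "\<And>\<rho>. \<rho> < 1 \<Longrightarrow> \<exists>M. \<forall>z\<in>cball 0 \<rho>. \<bar>pderiv_dir (pderiv_dir u v) v z\<bar> \<le> M"
    and p1: "\<And>z. ((\<lambda>t. \<phi> (z + t *\<^sub>R v)) has_real_derivative \<phi>' z) (at 0)"
    and p2: "\<And>z. ((\<lambda>t. \<phi>' (z + t *\<^sub>R v)) has_real_derivative \<phi>'' z) (at 0)"
    and cont: "continuous_on UNIV \<phi>" "continuous_on UNIV \<phi>'" "continuous_on UNIV \<phi>''"
    and R: "R < 1" "\<And>z. norm z > R \<Longrightarrow> \<phi> z = 0 \<and> \<phi>' z = 0 \<and> \<phi>'' z = 0"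
  shows "integrable lborel (\<lambda>z. \<phi> z * pderiv_dir (pderiv_dir u v) v z)"
    and "integrable lborel (\<lambda>z. u z * \<phi>'' z)"
    and "(\<integral>z. \<phi> z * pderiv_dir (pderiv_dir u v) v z \<partial>lborel) = (\<integral>z. u z * \<phi>'' z \<partial>lborel)"
proof -
  define u2 where "u2 = pderiv_dir (pderiv_dir u v) v"
  define G where "G z = \<phi> z * pderiv_dir u v z - u z * \<phi>' z" for z
  define G' where "G' z = \<phi> z * u2 z - u z * \<phi>'' z" for z
  have sub: "cball 0 R \<subseteq> (unit_ball :: (complex^'n) set)" using R(1) by auto
  have cu: "continuous_on (cball 0 R) u" and cu1: "continuous_on (cball 0 R) (pderiv_dir u v)"
      by (intro continuous_at_imp_continuous_on ballI differentiable_imp_continuous_within d1 d2; use sub in blast)+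
  have cph: "continuous_on (cball 0 R) \<phi>" "continuous_on (cball 0 R) \<phi>'" "continuous_on (cball 0 R) \<phi>''"
    using cont continuous_on_subset by blast+
  have ind: "integrable lborel g" if "continuous_on (cball 0 R) g" "\<And>z. norm z > R \<Longrightarrow> g z = 0" for g :: "complex^'n \<Rightarrow> real"
  proof -
    have "integrable lborel (\<lambda>z. indicator (cball 0 R) z *\<^sub>R g z)"
      by (intro borel_integrable_compact that compact_cball)
    moreover have "(\<lambda>z. indicator (cball 0 R) z *\<^sub>R g z) = g"
      using that(2) by (auto simp: indicator_def fun_eq_iff)
    ultimately show ?thesis by simp
  qed
  have Gi: "integrable lborel G"
  proof (rule ind)
    show "continuous_on (cball 0 R) G"
      unfolding G_def by (intro continuous_on_diff continuous_on_mult cu cu1 cph)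
  qed (simp add: G_def R)
  have der: "((\<lambda>t. G (z + t *\<^sub>R v)) has_real_derivative G' z) (at 0)" for z
  proof (cases "norm z < 1")
    case True
    then have z: "z \<in> unit_ball" by simp
    show ?thesis unfolding G_def G'_def u2_def
      using DERIV_diff[OF DERIV_mult[OF p1[of z] has_real_derivative_line[OF d2[OF z], of v]]
          DERIV_mult[OF has_real_derivative_line[OF d1[OF z], of v] p2[of z]]]
      by (simp add: algebra_simps)
  next
    case False
    \<comment> \<open>Outside the ball nothing is known about \<open>u\<close>, but
      \<open>R < 1\<close> makes \<open>G\<close> vanish near such a point.\<close>
    have "open {t. R < norm (z + t *\<^sub>R v)}"
      by (intro open_Collect_less continuous_intros)
    then have "\<forall>\<^sub>F t in nhds 0. t \<in> {t. R < norm (z + t *\<^sub>R v)}"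
      using False R by (intro eventually_nhds_in_open) auto
    then have "\<forall>\<^sub>F t in nhds 0. G (z + t *\<^sub>R v) = 0"
      by (rule eventually_mono) (auto simp: G_def R)
    moreover have "G' z = 0" using False R by (simp add: G'_def)
    ultimately show ?thesis by (subst DERIV_cong_ev[OF refl _ refl]) auto
  qed
  obtain M where M: "M \<ge> 0" "\<And>z. z \<in> cball 0 R \<Longrightarrow> \<bar>u2 z\<bar> \<le> M"
  proof -
    from bd[OF R(1)] obtain M where "\<forall>z\<in>cball 0 R. \<bar>u2 z\<bar> \<le> M" unfolding u2_def by blast
    then show ?thesis by (intro that[of "max 0 M"]) (auto simp: le_max_iff_disj)
  qed
  obtain M1 where M1: "M1 \<ge> 0" "\<And>z. z \<in> cball 0 R \<Longrightarrow> norm (\<phi> z) \<le> M1"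
    using continuous_on_compact_bound_norm[OF compact_cball cph(1)] by metis
  obtain M2 where M2: "M2 \<ge> 0" "\<And>z. z \<in> cball 0 R \<Longrightarrow> norm (u z * \<phi>'' z) \<le> M2"
    using continuous_on_compact_bound_norm[OF compact_cball continuous_on_mult[OF cu cph(3)]] by metis
  have G'b: "\<bar>G' z\<bar> \<le> M1 * M + M2" for z
  proof (cases "norm z \<le> R")
    case True
    then have z: "z \<in> cball 0 R" by simp
    have "\<bar>G' z\<bar> \<le> \<bar>\<phi> z * u2 z\<bar> + \<bar>u z * \<phi>'' z\<bar>"
      unfolding G'_def by (rule abs_triangle_ineq4)
    moreover have "\<bar>\<phi> z * u2 z\<bar> \<le> M1 * M"
      unfolding abs_mult using M1(2)[OF z] M(2)[OF z] M1(1) by (intro mult_mono) simp_all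
    ultimately show ?thesis using M2(2)[OF z] by simp
  qed (use M(1) M1(1) M2(1) in \<open>simp add: G'_def R\<close>)
  note res = integral_directional_derivative_compact_support[OF Gi der G'b, where R=R]
  have G'i: "integrable lborel G'" and G'0: "(\<integral>z. G' z \<partial>lborel) = 0"
    using res by (simp_all add: G_def R)
  show i2: "integrable lborel (\<lambda>z. u z * \<phi>'' z)"
    by (rule ind[OF continuous_on_mult[OF cu cph(3)]]) (simp add: R)
  \<comment> \<open>The second derivative of \<open>u\<close> is not known to be continuous, so
    integrability of this product is obtained by adding the continuous term back to
    \<open>G'\<close>.\<close>
  from Bochner_Integration.integrable_add[OF G'i i2]
  show i1: "integrable lborel (\<lambda>z. \<phi> z * pderiv_dir (pderiv_dir u v) v z)"
    by (simp add: G'_def u2_def)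
  show "(\<integral>z. \<phi> z * pderiv_dir (pderiv_dir u v) v z \<partial>lborel) = (\<integral>z. u z * \<phi>'' z \<partial>lborel)"
    using G'0 i1 i2 unfolding G'_def[abs_def] u2_def by simp
qed

subsection \<open>The weighted integral of the Laplacian\<close>

lemma has_real_derivative_radial:
  fixes z v :: "'a::real_inner"
  assumes "(g has_real_derivative g') (at (b - z \<bullet> z))"
  shows "((\<lambda>t. g (b - (z + t *\<^sub>R v) \<bullet> (z + t *\<^sub>R v))) has_real_derivative g' * (- 2 * (z \<bullet> v))) (at 0)"
proof -
  have "(\<lambda>t. b - (z + t *\<^sub>R v) \<bullet> (z + t *\<^sub>R v)) = (\<lambda>t. b - z \<bullet> z - 2 * t * (z \<bullet> v) - t\<^sup>2 * (v \<bullet> v))"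
    by (auto simp: inner_add_left inner_add_right inner_commute power2_eq_square algebra_simps)
  moreover have "((\<lambda>t. b - z \<bullet> z - 2 * t * (z \<bullet> v) - t\<^sup>2 * (v \<bullet> v)) has_real_derivative - 2 * (z \<bullet> v)) (at 0)"
    by (auto intro!: derivative_eq_intros)
  ultimately have "((\<lambda>t. b - (z + t *\<^sub>R v) \<bullet> (z + t *\<^sub>R v)) has_real_derivative - 2 * (z \<bullet> v)) (at 0)"
    by simp
  from DERIV_chain'[OF this, of g g'] assms show ?thesis by simp
qed

lemma continuous_on_ramps:
  "continuous_on UNIV (ramp e)" "continuous_on UNIV (ramp' e)" "continuous_on UNIV (ramp'' e)"
  unfolding ramp_def[abs_def] ramp'_def[abs_def] ramp''_def[abs_def] divide_inverse
  by (intro continuous_intros)+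

lemma lap_regular_continuous_on:
  "lap_regular u \<Longrightarrow> continuous_on unit_ball u"
  unfolding lap_regular_def
  by (auto intro!: continuous_at_imp_continuous_on differentiable_imp_continuous_within)

text \<open>The factor \<open>4 / e\<close> from the second derivative of the cutoff,
  \<open>4 * 2 ^ DIM\<close> from the shell estimate and the shell width \<open>2 * e\<close>
  multiply to \<open>32 * 2 ^ DIM\<close>: the cancellation of \<open>e\<close> is the point. The
  minorant \<open>l\<close> stands in for the Laplacian on the left, so that the limit
  \<open>e\<close> to 0 can be taken for a continuous function.\<close>

lemma nn_integral_truncated_laplacian_le:
  fixes u l :: "complex^'n \<Rightarrow> real"
  assumes u: "lap_regular u" "\<And>z. z \<in> unit_ball \<Longrightarrow> 0 \<le> u z"
    and l: "\<And>z. z \<in> unit_ball \<Longrightarrow> 0 \<le> l z \<and> l z \<le> laplacian u z"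
    and C: "\<And>r. 0 < r \<Longrightarrow> r < 1 \<Longrightarrow>
        (\<integral>\<^sup>+z. ennreal (indicator unit_ball (r *\<^sub>R (z /\<^sub>R norm z)) *\<^sub>R u (r *\<^sub>R (z /\<^sub>R norm z)))
             * indicator unit_ball z \<partial>lborel) \<le> C"
    and e: "0 < e" "e \<le> 1/4"
  shows "(\<integral>\<^sup>+z. ennreal (max 0 (1 - 2 * e - z \<bullet> z) * l z) \<partial>lborel)
    \<le> ennreal (32 * 2 ^ DIM(complex^'n)) * C"
proof -
  define b where "b = 1 - e"
  define \<phi> where "\<phi> z = ramp e (b - z \<bullet> z)" for z :: "complex^'n"
  define \<phi>' where "\<phi>' v z = ramp' e (b - z \<bullet> z) * (- 2 * (z \<bullet> v))" for v z :: "complex^'n"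
  define \<phi>'' where "\<phi>'' v z = ramp'' e (b - z \<bullet> z) * (4 * (z \<bullet> v)\<^sup>2) - 2 * ramp' e (b - z \<bullet> z) * (v \<bullet> v)"
    for v z :: "complex^'n"
  have p1: "((\<lambda>t. \<phi> (z + t *\<^sub>R v)) has_real_derivative \<phi>' v z) (at 0)" for z v
    unfolding \<phi>_def \<phi>'_def by (intro has_real_derivative_radial DERIV_ramp e)
  have p2: "((\<lambda>t. \<phi>' v (z + t *\<^sub>R v)) has_real_derivative \<phi>'' v z) (at 0)" for z v
  proof -
    have "((\<lambda>t. - 2 * ((z + t *\<^sub>R v) \<bullet> v)) has_real_derivative - 2 * (v \<bullet> v)) (at 0)"
      unfolding inner_add_left inner_scaleR_left by (auto intro!: derivative_eq_intros)
    from DERIV_mult[OF has_real_derivative_radial[OF DERIV_ramp'[OF e(1)], of b z v] this]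
    show ?thesis unfolding \<phi>'_def \<phi>''_def by (simp add: algebra_simps power2_eq_square)
  qed
  have comp: "continuous_on UNIV (\<lambda>z::complex^'n. g (b - z \<bullet> z))" if "continuous_on UNIV g" for g :: "real \<Rightarrow> real"
    by (rule continuous_on_compose2[OF that]) (auto intro!: continuous_intros)
  have cont: "continuous_on UNIV \<phi>" "continuous_on UNIV (\<phi>' v)" "continuous_on UNIV (\<phi>'' v)" for v
    unfolding \<phi>_def[abs_def] \<phi>'_def[abs_def] \<phi>''_def[abs_def]
    by (intro comp continuous_on_ramps continuous_intros)+
  define R where "R = sqrt b"
  have R: "R < 1" using e by (simp add: R_def b_def)
  have zR: "b < z \<bullet> z" if "norm z > R" for z :: "complex^'n"
    using that real_sqrt_less_iff[of b "z \<bullet> z"] by (simp add: R_def norm_eq_sqrt_inner)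
  have supp: "\<phi> z = 0 \<and> \<phi>' v z = 0 \<and> \<phi>'' v z = 0" if "norm z > R" for v z
    using zR[OF that] e by (simp add: \<phi>_def \<phi>'_def \<phi>''_def ramp_zero)
  note bp = integral_second_directional_by_parts[OF _ _ _ p1 p2 cont R supp, where u = u]
  have bp1: "integrable lborel (\<lambda>z. \<phi> z * pderiv_dir (pderiv_dir u v) v z)"
    and bp2: "integrable lborel (\<lambda>z. u z * \<phi>'' v z)"
    and bp3: "(\<integral>z. \<phi> z * pderiv_dir (pderiv_dir u v) v z \<partial>lborel) = (\<integral>z. u z * \<phi>'' v z \<partial>lborel)"
    if "v \<in> Basis" for v
    using u(1) that unfolding lap_regular_def by (intro bp; blast)+
  define \<Phi> where "\<Phi> z = (\<Sum>v\<in>Basis. \<phi>'' v z)" for z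
  \<comment> \<open>\<alpha> and \<open>R\<close> are the radii at which
    \<open>b - z \<bullet> z\<close> equals \<open>2 * e\<close> and 0, the ends of the tent. As
    \<open>b - 2 * e = 1 - 3 * e\<close>, the bound \<open>e\<close> \<le> 1/4 yields \<alpha> \<ge>
    1/2.\<close>
  define \<alpha> where "\<alpha> = sqrt (b - 2 * e)"
  define S where "S = {w :: complex^'n. \<alpha> \<le> norm w \<and> norm w \<le> R}"
  have ab: "1/2 \<le> \<alpha>" "\<alpha> \<le> R"
  proof -
    have "sqrt ((1/2)\<^sup>2) \<le> \<alpha>" unfolding \<alpha>_def
      using e by (intro real_sqrt_le_mono) (simp add: b_def power2_eq_square)
    then show "1/2 \<le> \<alpha>" by simp
    show "\<alpha> \<le> R" unfolding \<alpha>_def R_def using e by simp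
  qed
  have Ra: "R - \<alpha> \<le> 2 * e"
  proof -
    have "R\<^sup>2 = b" "\<alpha>\<^sup>2 = b - 2 * e" using e by (simp_all add: R_def \<alpha>_def b_def)
    then have "(R - \<alpha>) * (R + \<alpha>) = 2 * e" by (simp add: algebra_simps power2_eq_square)
    moreover have "(R - \<alpha>) * 1 \<le> (R - \<alpha>) * (R + \<alpha>)" using ab by (intro mult_left_mono) auto
    ultimately show ?thesis by simp
  qed
  have \<Phi>: "\<Phi> z = 4 * (z \<bullet> z) * ramp'' e (b - z \<bullet> z) - 2 * DIM(complex^'n) * ramp' e (b - z \<bullet> z)" for z
  proof -
    have "(\<Sum>v\<in>Basis. (z \<bullet> v)\<^sup>2) = z \<bullet> z"
      by (subst euclidean_inner) (simp add: power2_eq_square)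
    moreover have "(\<Sum>v\<in>(Basis :: (complex^'n) set). v \<bullet> v) = DIM(complex^'n)"
      by simp
    ultimately show ?thesis
      unfolding \<Phi>_def \<phi>''_def sum_subtractf sum_distrib_left[symmetric] by (simp del: DIM_cart)
  qed
  have uPhi: "u z * \<Phi> z \<le> 4 / e * (indicator S z *\<^sub>R u z)" for z
  proof (cases "norm z < 1")
    case True
    have zz: "z \<bullet> z \<le> 1" using True by (simp add: dot_square_norm abs_square_le_1)
    have "b - z \<bullet> z \<in> {0..2*e} \<longleftrightarrow> z \<in> S"
      using real_sqrt_le_iff[of "b - 2 * e" "z \<bullet> z"] real_sqrt_le_iff[of "z \<bullet> z" b]
      by (auto simp: S_def R_def \<alpha>_def norm_eq_sqrt_inner)
    then have r: "ramp'' e (b - z \<bullet> z) \<le> indicator S z / e"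
      using ramp''_le[OF e(1), of "b - z \<bullet> z"] by (simp add: indicator_def)
    have "\<Phi> z \<le> 4 * (z \<bullet> z) * ramp'' e (b - z \<bullet> z)"
      unfolding \<Phi> using ramp'_nonneg[OF e(1), of "b - z \<bullet> z"] by simp
    also have "\<dots> \<le> 4 * (z \<bullet> z) * (indicator S z / e)"
      using r by (intro mult_left_mono) auto
    also have "\<dots> \<le> 4 * 1 * (indicator S z / e)"
      using zz e by (intro mult_right_mono mult_left_mono) auto
    finally show ?thesis using u(2)[of z] True mult_left_mono[of "\<Phi> z" "4 * 1 * (indicator S z / e)" "u z"]
      by (simp add: mult_ac)
  next
    case False
    then have "norm z > R" using R by simp
    then show ?thesis using supp by (simp add: \<Phi>_def S_def)
  qed
  have cS: "compact S"
  proof -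
    have "S = cball 0 R - ball 0 \<alpha>" by (auto simp: S_def)
    then show ?thesis by (simp add: compact_diff)
  qed
  have Sb: "S \<subseteq> unit_ball" using R by (auto simp: S_def)
  have "integrable lborel (\<lambda>z. indicator S z *\<^sub>R u z)"
    using lap_regular_continuous_on[OF u(1)] Sb
    by (intro borel_integrable_compact cS) (rule continuous_on_subset)
  then have hi: "integrable lborel (\<lambda>z. 4 / e * (indicator S z *\<^sub>R u z))" by (rule integrable_mult_right)
  have Li: "integrable lborel (\<lambda>z. \<phi> z * laplacian u z)"
    unfolding laplacian_def sum_distrib_left by (intro Bochner_Integration.integrable_sum bp1)
  have Pi: "integrable lborel (\<lambda>z. u z * \<Phi> z)"
    unfolding \<Phi>_def sum_distrib_left by (intro Bochner_Integration.integrable_sum bp2)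
  have eq: "(\<integral>z. \<phi> z * laplacian u z \<partial>lborel) = (\<integral>z. u z * \<Phi> z \<partial>lborel)"
    unfolding laplacian_def \<Phi>_def sum_distrib_left
    by (subst (1 2) Bochner_Integration.integral_sum) (auto simp: bp1 bp2 bp3)
  \<comment> \<open>One \<open>e\<close> comes from \<open>b = 1 - e\<close>, the other from the
    shift in the lower bound for \<open>ramp\<close>.\<close>
  have phige: "max 0 (1 - 2 * e - z \<bullet> z) \<le> \<phi> z" for z
    using ramp_ge[OF e(1), of "b - z \<bullet> z"] by (simp add: \<phi>_def b_def algebra_simps)
  have low: "max 0 (1 - 2 * e - z \<bullet> z) * l z \<le> \<phi> z * laplacian u z \<and> 0 \<le> \<phi> z * laplacian u z" for z
  proof (cases "norm z < 1")
    case True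
    then show ?thesis using l[of z] phige[of z]
      by (auto intro!: mult_mono mult_nonneg_nonneg intro: order_trans)
  next
    case False
    then have "norm z > R" using R by simp
    moreover have "1 \<le> z \<bullet> z" using False by (simp add: dot_square_norm abs_square_less_1 not_less)
    ultimately show ?thesis using supp e by simp
  qed
  have "(\<integral>\<^sup>+z. ennreal (max 0 (1 - 2 * e - z \<bullet> z) * l z) \<partial>lborel) \<le> (\<integral>\<^sup>+z. ennreal (\<phi> z * laplacian u z) \<partial>lborel)"
    using low by (intro nn_integral_mono ennreal_leI) auto
  also have "\<dots> = ennreal (\<integral>z. \<phi> z * laplacian u z \<partial>lborel)"
    using low by (intro nn_integral_eq_integral Li) auto
  also have "\<dots> \<le> ennreal (\<integral>z. 4 / e * (indicator S z *\<^sub>R u z) \<partial>lborel)"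
    unfolding eq by (intro ennreal_leI integral_mono Pi hi uPhi)
  also have "\<dots> = (\<integral>\<^sup>+z. ennreal (4 / e * (indicator S z *\<^sub>R u z)) \<partial>lborel)"
  proof (rule nn_integral_eq_integral[symmetric, OF hi], rule AE_I2)
    fix z show "0 \<le> 4 / e * (indicator S z *\<^sub>R u z)"
      using u(2)[of z] Sb e by (auto simp: indicator_def)
  qed
  also have "\<dots> = (\<integral>\<^sup>+z. ennreal (4 / e) * (ennreal (indicator unit_ball z *\<^sub>R u z) * indicator S z) \<partial>lborel)"
    using Sb e by (intro nn_integral_cong) (auto simp: indicator_def simp flip: ennreal_mult')
  also have "\<dots> = ennreal (4 / e) * (\<integral>\<^sup>+z. ennreal (indicator unit_ball z *\<^sub>R u z) * indicator S z \<partial>lborel)"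
  proof (rule nn_integral_cmult)
    define V where "V z = indicator unit_ball z *\<^sub>R u z" for z
    have [measurable]: "V \<in> borel_measurable borel"
      unfolding V_def[abs_def] by (intro borel_measurable_continuous_on_indicator lap_regular_continuous_on u) auto
    have [measurable]: "S \<in> sets borel" using cS by (simp add: borel_compact)
    show "(\<lambda>z. ennreal (indicator unit_ball z *\<^sub>R u z) * indicator S z) \<in> borel_measurable lborel"
      unfolding V_def[symmetric] by measurable
  qed
  also have "\<dots> \<le> ennreal (4 / e) * (ennreal (4 * 2 ^ DIM(complex^'n)) * (ennreal (R - \<alpha>) * C))"
    unfolding S_def
  proof (intro mult_left_mono nn_integral_shell_le C ab R)
    show "(\<lambda>z. ennreal (indicator unit_ball z *\<^sub>R u z)) \<in> borel_measurable borel"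
      by (intro measurable_compose[OF _ measurable_ennreal]
          borel_measurable_continuous_on_indicator lap_regular_continuous_on u) auto
  qed auto
  also have "\<dots> = ennreal (4 / e * (4 * 2 ^ DIM(complex^'n)) * (R - \<alpha>)) * C"
  proof -
    have nn: "0 \<le> 4 / e" "0 \<le> (4 * 2 ^ DIM(complex^'n) :: real)" "0 \<le> R - \<alpha>" using e ab by simp_all
    show ?thesis
      unfolding ennreal_mult[OF mult_nonneg_nonneg[OF nn(1,2)] nn(3)] ennreal_mult[OF nn(1,2)]
      by (simp only: mult.assoc)
  qed
  also have "\<dots> \<le> ennreal (32 * 2 ^ DIM(complex^'n)) * C"
  proof (intro mult_right_mono ennreal_leI)
    have "4 / e * (4 * 2 ^ DIM(complex^'n)) * (R - \<alpha>) \<le> 4 / e * (4 * 2 ^ DIM(complex^'n)) * (2 * e)"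
      using e Ra by (intro mult_left_mono) auto
    then show "4 / e * (4 * 2 ^ DIM(complex^'n)) * (R - \<alpha>) \<le> 32 * 2 ^ DIM(complex^'n)"
      using e by simp
  qed auto
  finally show ?thesis .
qed

text \<open>Fatou along a sequence of truncations, for which the bound does not depend on the
  parameter. Outside the ball the weight is 0, so \<open>l\<close> may be replaced there by 0, which
  makes it Borel measurable.\<close>

lemma nn_integral_weighted_laplacian_le:
  fixes u l :: "complex^'n \<Rightarrow> real"
  assumes u: "lap_regular u" "\<And>z. z \<in> unit_ball \<Longrightarrow> 0 \<le> u z"
    and l: "\<And>z. z \<in> unit_ball \<Longrightarrow> 0 \<le> l z \<and> l z \<le> laplacian u z"
    and lc: "continuous_on unit_ball l"
    and C: "\<And>r. 0 < r \<Longrightarrow> r < 1 \<Longrightarrow>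
        (\<integral>\<^sup>+z. ennreal (indicator unit_ball (r *\<^sub>R (z /\<^sub>R norm z)) *\<^sub>R u (r *\<^sub>R (z /\<^sub>R norm z)))
             * indicator unit_ball z \<partial>lborel) \<le> C"
  shows "(\<integral>\<^sup>+z. ennreal (max 0 (1 - z \<bullet> z) * l z) \<partial>lborel) \<le> ennreal (32 * 2 ^ DIM(complex^'n)) * C"
proof -
  define l0 where "l0 z = indicator unit_ball z *\<^sub>R l z" for z
  have [measurable]: "l0 \<in> borel_measurable borel"
    unfolding l0_def[abs_def] by (intro borel_measurable_continuous_on_indicator lc) auto
  \<comment> \<open>The shift by 4 gives \<epsilon> \<le> 1/4 already at
    \<open>k = 0\<close>.\<close>
  define \<epsilon> where "\<epsilon> k = 1 / real (k + 4)" for k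
  define g where "g k z = ennreal (max 0 (1 - 2 * \<epsilon> k - z \<bullet> z) * l0 z)" for k z
  have out: "1 \<le> z \<bullet> z" if "z \<notin> unit_ball" for z :: "complex^'n"
    using that by (simp add: dot_square_norm abs_square_less_1 not_less)
  have "\<epsilon> \<longlonglongrightarrow> 0"
    unfolding \<epsilon>_def using LIMSEQ_ignore_initial_segment[OF lim_1_over_n, of 4] by simp
  then have lim: "(\<lambda>k. g k z) \<longlonglongrightarrow> ennreal (max 0 (1 - 2 * 0 - z \<bullet> z) * l0 z)" for z
    unfolding g_def by (intro tendsto_intros)
  have "(\<integral>\<^sup>+z. ennreal (max 0 (1 - z \<bullet> z) * l z) \<partial>lborel) = (\<integral>\<^sup>+z. liminf (\<lambda>k. g k z) \<partial>lborel)"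
  proof (rule nn_integral_cong)
    fix z :: "complex^'n"
    have "liminf (\<lambda>k. g k z) = ennreal (max 0 (1 - 2 * 0 - z \<bullet> z) * l0 z)"
      by (rule lim_imp_Liminf[OF _ lim]) simp
    then show "ennreal (max 0 (1 - z \<bullet> z) * l z) = liminf (\<lambda>k. g k z)"
      using out[of z] by (cases "z \<in> unit_ball") (auto simp: l0_def)
  qed
  also have "\<dots> \<le> liminf (\<lambda>k. \<integral>\<^sup>+z. g k z \<partial>lborel)"
    unfolding g_def by (intro nn_integral_liminf) measurable
  also have "\<dots> \<le> ennreal (32 * 2 ^ DIM(complex^'n)) * C"
  proof (rule Liminf_le, simp, rule always_eventually, rule allI)
    fix k
    have ek: "0 < \<epsilon> k" "\<epsilon> k \<le> 1/4" by (simp_all add: \<epsilon>_def field_simps)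
    have "(\<integral>\<^sup>+z. g k z \<partial>lborel) = (\<integral>\<^sup>+z. ennreal (max 0 (1 - 2 * \<epsilon> k - z \<bullet> z) * l z) \<partial>lborel)"
    proof (rule nn_integral_cong)
      fix z :: "complex^'n"
      show "g k z = ennreal (max 0 (1 - 2 * \<epsilon> k - z \<bullet> z) * l z)"
        using out[of z] ek by (cases "z \<in> unit_ball") (auto simp: g_def l0_def)
    qed
    also have "\<dots> \<le> ennreal (32 * 2 ^ DIM(complex^'n)) * C"
      by (rule nn_integral_truncated_laplacian_le[OF u l C ek])
    finally show "(\<integral>\<^sup>+z. g k z \<partial>lborel) \<le> ennreal (32 * 2 ^ DIM(complex^'n)) * C" .
  qed
  finally show ?thesis .
qed

section \<open>Passage between the normalized measures and Lebesgue measure\<close>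

lemma nn_integral_dVN:
  fixes F :: "complex^'n \<Rightarrow> ennreal"
  assumes [measurable]: "F \<in> borel_measurable borel"
  shows "(\<integral>\<^sup>+z. F z \<partial>dVN)
    = ennreal (1 / measure lebesgue (unit_ball :: (complex^'n) set)) * (\<integral>\<^sup>+z. F z * indicator unit_ball z \<partial>lborel)"
proof -
  let ?V = "measure lebesgue (unit_ball :: (complex^'n) set)"
  have [measurable]: "Measurable.pred borel (\<lambda>z::complex^'n. z \<in> unit_ball)" by simp
  have F: "F \<in> borel_measurable lebesgue"
    by (rule measurable_completion) simp
  have I: "(\<lambda>z::complex^'n. ennreal (indicator unit_ball z / ?V)) \<in> borel_measurable lebesgue"
    by (intro measurable_completion measurable_compose[OF _ measurable_ennreal] borel_measurable_divide
        borel_measurable_indicator borel_measurable_const) simp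
  have "(\<integral>\<^sup>+z. F z \<partial>dVN) = (\<integral>\<^sup>+z. ennreal (indicator unit_ball z / ?V) * F z \<partial>lebesgue)"
    unfolding dVN_def by (rule nn_integral_density[OF I F])
  also have "\<dots> = (\<integral>\<^sup>+z. ennreal (1 / ?V) * (F z * indicator unit_ball z) \<partial>lebesgue)"
    by (intro nn_integral_cong) (auto simp: indicator_def)
  also have "\<dots> = (\<integral>\<^sup>+z. ennreal (1 / ?V) * (F z * indicator unit_ball z) \<partial>lborel)"
    by (rule nn_integral_completion)
  also have "\<dots> = ennreal (1 / ?V) * (\<integral>\<^sup>+z. F z * indicator unit_ball z \<partial>lborel)"
    by (rule nn_integral_cmult) measurable
  finally show ?thesis .
qed

lemma AE_dVN_unit_ball: "AE z in (dVN :: (complex^'n) measure). z \<in> unit_ball"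
proof -
  have I: "(\<lambda>z::complex^'n. ennreal (indicator unit_ball z / measure lebesgue (unit_ball :: (complex^'n) set)))
      \<in> borel_measurable lebesgue"
    by (intro measurable_completion measurable_compose[OF _ measurable_ennreal] borel_measurable_divide
        borel_measurable_indicator borel_measurable_const) simp
  show ?thesis unfolding dVN_def AE_density[OF I] by (auto simp: indicator_def)
qed

text \<open>The indicator makes the integrand Borel measurable, since f is arbitrary outside the ball.\<close>
lemma Mp_pow_eq:
  fixes f :: "complex^'n \<Rightarrow> complex"
  assumes f: "continuous_on unit_ball f" and p: "p > 0" and r: "0 < r" "r < 1"
  shows "(\<integral>\<^sup>+z. ennreal (indicator unit_ball (r *\<^sub>R (z /\<^sub>R norm z)) *\<^sub>R (cmod (f (r *\<^sub>R (z /\<^sub>R norm z))) powr p))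
      * indicator unit_ball z \<partial>lborel)
    = ennreal (measure lebesgue (unit_ball :: (complex^'n) set)) * Mp_pow p r f"
proof -
  let ?V = "measure lebesgue (unit_ball :: (complex^'n) set)"
  define U where "U w = ennreal (indicator unit_ball w *\<^sub>R (cmod (f w) powr p))" for w
  have [measurable]: "U \<in> borel_measurable borel"
    unfolding U_def[abs_def] using p
    by (intro measurable_compose[OF _ measurable_ennreal] borel_measurable_continuous_on_indicator
        continuous_on_powr' continuous_intros f) auto
  have proj[measurable]: "(\<lambda>z::complex^'n. z /\<^sub>R norm z) \<in> borel_measurable borel"
    by measurable
  have dm: "(\<lambda>z::complex^'n. z /\<^sub>R norm z) \<in> dVN \<rightarrow>\<^sub>M borel"
    unfolding dVN_def by (simp add: measurable_completion)
  \<comment> \<open>At \<open>z = 0\<close> the projection takes the value 0 by the convention for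
    division by zero, so its norm is at most 1 rather than equal to 1; with \<open>r < 1\<close>
    this keeps \<open>r *\<^sub>R \<zeta>\<close> in the ball.\<close>
  have n1: "norm (z /\<^sub>R norm z) \<le> 1" for z :: "complex^'n"
    by (cases "z = 0") auto
  have "AE \<zeta> in dsigma. norm (\<zeta> :: complex^'n) \<le> 1"
    unfolding dsigma_def by (subst AE_distr_iff[OF dm]) (simp_all add: n1 del: norm_scaleR)
  then have "Mp_pow p r f = (\<integral>\<^sup>+\<zeta>. U (r *\<^sub>R \<zeta>) \<partial>dsigma)"
    unfolding Mp_pow_def
  proof (intro nn_integral_cong_AE, elim eventually_mono)
    fix \<zeta> :: "complex^'n" assume "norm \<zeta> \<le> 1"
    then have "r * norm \<zeta> \<le> r * 1" using r by (intro mult_left_mono) auto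
    then have "r * norm \<zeta> < 1" using r by linarith
    then show "ennreal (cmod (f (r *\<^sub>R \<zeta>)) powr p) = U (r *\<^sub>R \<zeta>)"
      using r by (simp add: U_def)
  qed
  also have "\<dots> = (\<integral>\<^sup>+z. U (r *\<^sub>R (z /\<^sub>R norm z)) \<partial>dVN)"
    unfolding dsigma_def by (rule nn_integral_distr[OF dm]) measurable
  also have "\<dots> = ennreal (1 / ?V) * (\<integral>\<^sup>+z. U (r *\<^sub>R (z /\<^sub>R norm z)) * indicator unit_ball z \<partial>lborel)"
    by (rule nn_integral_dVN) measurable
  finally have "ennreal ?V * Mp_pow p r f = (ennreal ?V * ennreal (1 / ?V)) * (\<integral>\<^sup>+z. U (r *\<^sub>R (z /\<^sub>R norm z)) * indicator unit_ball z \<partial>lborel)"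
    by (simp add: mult.assoc)
  moreover have "ennreal ?V * ennreal (1 / ?V) = 1"
    using content_ball_pos[of 1 "0 :: complex^'n"] by (simp flip: ennreal_mult)
  ultimately show ?thesis unfolding U_def by simp
qed

theorem theorem1p12:
  fixes f :: "complex^'n \<Rightarrow> complex"
    and a1 b1 c1 :: "complex^'n \<Rightarrow> real"
    and p t1 t2 :: real
  assumes "p \<ge> 2" and "t1 > 0" and "t2 > 0"
    and "C2_on unit_ball f" and "f \<in> Hg p"
    and "continuous_on unit_ball a1" and "continuous_on unit_ball b1" and "continuous_on unit_ball c1"
    and "\<forall>z\<in>unit_ball. a1 z \<ge> 0 \<and> b1 z \<ge> 0 \<and> c1 z \<ge> 0"
    and "Inf (a1 ` unit_ball) + Inf (b1 ` unit_ball) > 0"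
    and "Inf (c1 ` unit_ball) \<ge> 0"
    and "\<forall>z\<in>unit_ball. laplacian (\<lambda>w. cmod (f w) powr p) z
            \<ge> a1 z * normDf f z powr t1 + b1 z * cmod (f z) powr t2 + c1 z"
  shows "(Inf (a1 ` unit_ball) > 0 \<longrightarrow> f \<in> Dclass 1 t1)
       \<and> (Inf (b1 ` unit_ball) > 0 \<longrightarrow> f \<in> bclass 1 t2)"
proof -
  let ?V = "measure lebesgue (unit_ball :: (complex^'n) set)"
  define u where "u = (\<lambda>w. cmod (f w) powr p)"
  define l where "l z = a1 z * normDf f z powr t1 + b1 z * cmod (f z) powr t2 + c1 z" for z
  have fc: "continuous_on unit_ball f" and pc: "\<And>v. v \<in> Basis \<Longrightarrow> continuous_on unit_ball (pderiv_dir f v)"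
    using C2_on_continuous[OF assms(4)] by blast+
  have ax: "axis k 1 \<in> (Basis :: (complex^'n) set)" "axis k \<i> \<in> (Basis :: (complex^'n) set)" for k
    by (auto simp: Basis_vec_def Basis_complex_def)
  have Dc: "continuous_on unit_ball (normDf f)"
    unfolding normDf_def[abs_def] dz_def dzbar_def by (intro continuous_intros pc ax) auto
  have Dp: "continuous_on unit_ball (\<lambda>z. normDf f z powr t1)"
    using assms(2) by (intro continuous_on_powr' Dc continuous_intros) (auto simp: normDf_def sum_nonneg)
  have fp: "continuous_on unit_ball (\<lambda>z. cmod (f z) powr t2)"
    using assms(3) by (intro continuous_on_powr' fc continuous_intros) auto
  have lc: "continuous_on unit_ball l"
    unfolding l_def[abs_def] by (intro continuous_intros Dp fp assms)
  have l: "0 \<le> l z \<and> l z \<le> laplacian u z" if "z \<in> unit_ball" for z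
    using assms(9,12) that unfolding l_def u_def by (auto intro!: add_nonneg_nonneg)
  obtain C where C: "\<And>r. 0 < r \<Longrightarrow> r < 1 \<Longrightarrow> Mp_pow p r f \<le> ennreal C"
    using assms(5) unfolding Hg_def mem_Collect_eq by (meson greaterThanLessThan_iff)
  have "(\<integral>\<^sup>+z. ennreal (max 0 (1 - z \<bullet> z) * l z) \<partial>lborel)
      \<le> ennreal (32 * 2 ^ DIM(complex^'n)) * (ennreal ?V * ennreal C)"
  proof (rule nn_integral_weighted_laplacian_le[OF _ _ l lc])
    show "lap_regular u" unfolding u_def by (rule lap_regular_norm_powr[OF assms(4,1)])
    fix r :: real assume r: "0 < r" "r < 1"
    show "(\<integral>\<^sup>+z. ennreal (indicator unit_ball (r *\<^sub>R (z /\<^sub>R norm z)) *\<^sub>R u (r *\<^sub>R (z /\<^sub>R norm z)))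
             * indicator unit_ball z \<partial>lborel) \<le> ennreal ?V * ennreal C"
      unfolding u_def using assms(1) by (subst Mp_pow_eq[OF fc _ r]) (auto intro!: mult_left_mono C r)
  qed (auto simp: u_def)
  also have "\<dots> < \<infinity>" by (simp add: ennreal_mult_less_top)
  finally have fin: "(\<integral>\<^sup>+z. ennreal (max 0 (1 - z \<bullet> z) * l z) \<partial>lborel) < \<infinity>" .
  \<comment> \<open>Both conclusions are instances: \<open>q\<close> is the power of the derivative
    norm or of |f|, and \<open>A\<close> the infimum of its coefficient.\<close>
  have main: "(\<integral>\<^sup>+z. ennreal (dist_bd z powr 1 * q z) \<partial>dVN) < \<infinity>"
    if A: "A > 0" and qc: "continuous_on unit_ball q" 
      and q: "\<And>z. z \<in> unit_ball \<Longrightarrow> 0 \<le> q z \<and> A * q z \<le> l z" for A and q :: "complex^'n \<Rightarrow> real"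
  proof -
    define F where "F z = ennreal (indicator unit_ball z *\<^sub>R ((1 - norm z) * q z))" for z
    have F[measurable]: "F \<in> borel_measurable borel"
      unfolding F_def[abs_def]
      by (intro measurable_compose[OF _ measurable_ennreal] borel_measurable_continuous_on_indicator
        continuous_intros qc) auto
    have l0: "(\<lambda>z. indicator unit_ball z *\<^sub>R l z) \<in> borel_measurable borel"
      by (intro borel_measurable_continuous_on_indicator lc) auto
    have "(\<integral>\<^sup>+z. ennreal (dist_bd z powr 1 * q z) \<partial>dVN) = (\<integral>\<^sup>+z. F z \<partial>dVN)"
    proof (intro nn_integral_cong_AE eventually_mono[OF AE_dVN_unit_ball])
      fix z :: "complex^'n" assume "z \<in> unit_ball"
      then show "ennreal (dist_bd z powr 1 * q z) = F z" by (simp add: F_def dist_bd_def)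
    qed
    also have "\<dots> = ennreal (1 / ?V) * (\<integral>\<^sup>+z. F z * indicator unit_ball z \<partial>lborel)"
      by (rule nn_integral_dVN[OF F])
    also have "\<dots> \<le> ennreal (1 / ?V) * (\<integral>\<^sup>+z. ennreal (1 / A) * ennreal (max 0 (1 - z \<bullet> z) * (indicator unit_ball z *\<^sub>R l z)) \<partial>lborel)"
    proof (intro mult_left_mono nn_integral_mono)
      fix z :: "complex^'n"
      show "F z * indicator unit_ball z \<le> ennreal (1 / A) * ennreal (max 0 (1 - z \<bullet> z) * (indicator unit_ball z *\<^sub>R l z))"
      proof (cases "z \<in> unit_ball")
        case True
        then have n: "norm z < 1" by simp
        \<comment> \<open>This exchanges the weights: 1 - |z| is at most 1 - |z|^2 in the unit
          ball.\<close>
        have "norm z * norm z \<le> norm z * 1" using n by (intro mult_left_mono) auto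
        then have "1 - norm z \<le> max 0 (1 - z \<bullet> z)"
          by (simp add: dot_square_norm power2_eq_square)
        moreover have "q z \<le> (1 / A) * l z" using q[OF True] A by (simp add: field_simps)
        ultimately have "(1 - norm z) * q z \<le> max 0 (1 - z \<bullet> z) * ((1 / A) * l z)"
          using q[OF True] n by (intro mult_mono) auto
        then have "(1 - norm z) * q z \<le> (1 / A) * (max 0 (1 - z \<bullet> z) * l z)"
          by (simp add: mult_ac)
        then show ?thesis using True A by (simp add: F_def ennreal_leI flip: ennreal_mult')
      qed (simp add: F_def)
    qed auto
    also have "\<dots> = ennreal (1 / ?V) * (ennreal (1 / A) * (\<integral>\<^sup>+z. ennreal (max 0 (1 - z \<bullet> z) * (indicator unit_ball z *\<^sub>R l z)) \<partial>lborel))"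
      using l0 by (subst nn_integral_cmult) auto
    also have "\<dots> \<le> ennreal (1 / ?V) * (ennreal (1 / A) * (\<integral>\<^sup>+z. ennreal (max 0 (1 - z \<bullet> z) * l z) \<partial>lborel))"
      by (intro mult_left_mono nn_integral_mono) (auto simp: indicator_def)
    also have "\<dots> < \<infinity>" using fin by (simp add: ennreal_mult_less_top)
    finally show ?thesis .
  qed
  \<comment> \<open>Nonnegativity bounds the image from below, without which the real
    \<open>Inf\<close> need not be a lower bound.\<close>
  have inf: "Inf (h ` unit_ball) \<le> h z" if "\<forall>z\<in>unit_ball. h z \<ge> 0" "z \<in> unit_ball" for h :: "complex^'n \<Rightarrow> real" and z
    using that by (intro cINF_lower bdd_belowI2[where m = 0]) auto
  show ?thesis
  proof (intro conjI impI)
    assume A: "Inf (a1 ` unit_ball) > 0"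
    have "(\<integral>\<^sup>+z. ennreal (dist_bd z powr 1 * normDf f z powr t1) \<partial>dVN) < \<infinity>"
    proof (rule main[OF A Dp])
      fix z :: "complex^'n" assume z: "z \<in> unit_ball"
      have "Inf (a1 ` unit_ball) * normDf f z powr t1 \<le> a1 z * normDf f z powr t1"
        using inf[of a1 z] assms(9) z by (intro mult_right_mono) auto
      moreover have "0 \<le> b1 z * cmod (f z) powr t2" "0 \<le> c1 z" using assms(9) z by auto
      ultimately show "0 \<le> normDf f z powr t1 \<and> Inf (a1 ` unit_ball) * normDf f z powr t1 \<le> l z"
        unfolding l_def by auto
    qed
    moreover have "C1_on unit_ball f" using assms(4) pc unfolding C1_on_def C2_on_def by auto
    ultimately show "f \<in> Dclass 1 t1" by (simp add: Dclass_def)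
  next
    assume A: "Inf (b1 ` unit_ball) > 0"
    have "(\<integral>\<^sup>+z. ennreal (dist_bd z powr 1 * cmod (f z) powr t2) \<partial>dVN) < \<infinity>"
    proof (rule main[OF A fp])
      fix z :: "complex^'n" assume z: "z \<in> unit_ball"
      have "Inf (b1 ` unit_ball) * cmod (f z) powr t2 \<le> b1 z * cmod (f z) powr t2"
        using inf[of b1 z] assms(9) z by (intro mult_right_mono) auto
      moreover have "0 \<le> a1 z * normDf f z powr t1" "0 \<le> c1 z" using assms(9) z by auto
      ultimately show "0 \<le> cmod (f z) powr t2 \<and> Inf (b1 ` unit_ball) * cmod (f z) powr t2 \<le> l z"
        unfolding l_def by auto
    qed
    then show "f \<in> bclass 1 t2" using fc by (simp add: bclass_def)
  qed
qed

end
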